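(* Let $r^m_n$, $(n,m)\in\mathbb{Z}^2$, be the octahedral functions defined in the context, and let $\tilde r^m_n(s):=r^m_n(s^4)$. Let $q_{\rm v}(s)=s(1-s^4)$ and $q_{\rm f}(s)=1+14s^4+s^8$. For $m=0$ and for $m=-1$, the family $\{\tilde r^m_n(s)\}_{n\in\mathbb{Z}}$ is biorthogonal on the $s$-interval $[0,1]$ in the following sense: the integral $$\int_0^1\left[q_{\rm v}(s)^{-2m}\,q_{\rm f}(s)^{-3n/2}\,\tilde r^m_n(s)\right]\left[q_{\rm v}(s)^{-2m}\,q_{\rm f}(s)^{-3n'/2}\,(1-s)^{1+12m+12n'}\,\tilde r^m_{n'}\!\left(\frac{1+s}{1-s}\right)\right]\frac{q_{\rm v}(s)^2}{q_{\rm f}(s)^2}\,{\rm d}s$$ equals zero if the integers $n,n'$ differ by a nonzero even integer.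
   Context: Octahedral functions: let $p_{\rm v}(u)=u(1-u)^4$, $p_{\rm e}(u)=(1+u)(1-34u+u^2)$, $p_{\rm f}(u)=1+14u+u^2$, and $R(u)=-108\,p_{\rm v}(u)/p_{\rm e}(u)^2=1-p_{\rm f}(u)^3/p_{\rm e}(u)^2$. For $(n,m)\in\mathbb{Z}^2$, $r^m_n$ is the rational function of $u$ that on a neighborhood of $u=0$ satisfies $${}_2F_1\!\left(-\tfrac1{24}-\tfrac m2-\tfrac n2,\ \tfrac{11}{24}-\tfrac m2-\tfrac n2;\ \tfrac34-m;\ R(u)\right)=p_{\rm e}(u)^{-1/12-m-n}\,r^m_n(u)$$ (with powers of $p_{\rm e}(u)$ equal to $1$ at $u=0$), ${}_2F_1$ being the Gauss function. *)

theory Defs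
  imports "HOL-Analysis.Analysis" "HOL-Computational_Algebra.Computational_Algebra"
begin

definition p_v :: "real \<Rightarrow> real" where
  "p_v u = u * (1 - u) ^ 4"

definition p_e :: "real \<Rightarrow> real" where
  "p_e u = (1 + u) * (1 - 34 * u + u ^ 2)"

definition p_f :: "real \<Rightarrow> real" where
  "p_f u = 1 + 14 * u + u ^ 2"

definition oct_R :: "real \<Rightarrow> real" where
  "oct_R u = - 108 * p_v u / (p_e u) ^ 2"

lemma oct_R_alt: "p_e u \<noteq> 0 \<Longrightarrow> oct_R u = 1 - (p_f u) ^ 3 / (p_e u) ^ 2"
proof -
  assume "p_e u \<noteq> 0"
  moreover have "(p_e u) ^ 2 - (p_f u) ^ 3 = - 108 * p_v u"
    unfolding p_e_def p_f_def p_v_def by algebra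
  ultimately show ?thesis
    unfolding oct_R_def by (simp add: field_simps)
qed

definition hyp2F1 :: "real \<Rightarrow> real \<Rightarrow> real \<Rightarrow> real \<Rightarrow> real" where
  "hyp2F1 a b c x = eval_fps (fps_hypergeo [a, b] [c] 1) x"

lemma hyp2F1_series:
  "hyp2F1 a b c x =
     (\<Sum>k. pochhammer a k * pochhammer b k / (pochhammer c k * fact k) * x ^ k)"
  by (simp add: hyp2F1_def eval_fps_def)

text \<open>Rational functions are taken in lowest terms, so that the value at every removable
  singularity is the correct one; at a genuine pole the value is \<open>0\<close> by the convention
  for division.\<close>

definition rational_fun :: "(real \<Rightarrow> real) \<Rightarrow> bool" where
  "rational_fun f \<longleftrightarrow>
     (\<exists>p q :: real poly. q \<noteq> 0 \<and> coprime p q \<and> (\<forall>u. f u = poly p u / poly q u))"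

text \<open>The predicate characterizes \<open>f\<close> as the octahedral function with lower index \<open>n\<close> and
  upper index \<open>m\<close>. A rational function is determined by its values near \<open>0\<close>, so at most
  one \<open>f\<close> qualifies. Since \<open>p_e 0 = 1\<close>, the base of the real power is positive near \<open>0\<close>
  and the power equals \<open>1\<close> at \<open>0\<close>; moreover \<open>oct_R 0 = 0\<close>, so the Gauss series converges
  near \<open>0\<close>.\<close>

definition octahedral_function :: "int \<Rightarrow> int \<Rightarrow> (real \<Rightarrow> real) \<Rightarrow> bool" where
  "octahedral_function n m f \<longleftrightarrow>
     rational_fun f \<and>
     (\<forall>\<^sub>F u in nhds 0.
        hyp2F1 (- 1 / 24 - of_int m / 2 - of_int n / 2)
               (11 / 24 - of_int m / 2 - of_int n / 2)
               (3 / 4 - of_int m) (oct_R u)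
        = p_e u powr (- 1 / 12 - of_int m - of_int n) * f u)"

definition q_v :: "real \<Rightarrow> real" where
  "q_v s = s * (1 - s ^ 4)"

definition q_f :: "real \<Rightarrow> real" where
  "q_f s = 1 + 14 * s ^ 4 + s ^ 8"

text \<open>In the integrand below, \<open>r n m\<close> stands for the octahedral function with lower index
  \<open>n\<close> and upper index \<open>m\<close>. The exponents of \<open>q_v\<close> and of \<open>1 - s\<close> are integers, those of
  \<open>q_f\<close> half-integers, and \<open>q_f\<close> is positive. At the endpoint \<open>s = 1\<close> the argument
  \<open>(1 + s) / (1 - s)\<close> takes a conventional value, which does not affect the integral.\<close>

definition oct_tilde :: "(int \<Rightarrow> int \<Rightarrow> real \<Rightarrow> real) \<Rightarrow> int \<Rightarrow> int \<Rightarrow> real \<Rightarrow> real" where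
  "oct_tilde r n m s = r n m (s ^ 4)"

definition oct_integrand ::
    "(int \<Rightarrow> int \<Rightarrow> real \<Rightarrow> real) \<Rightarrow> int \<Rightarrow> int \<Rightarrow> int \<Rightarrow> real \<Rightarrow> real" where
  "oct_integrand r m n n' s =
     (q_v s powi (- 2 * m) * q_f s powr (- 3 * of_int n / 2) * oct_tilde r n m s) *
     (q_v s powi (- 2 * m) * q_f s powr (- 3 * of_int n' / 2) *
        (1 - s) powi (1 + 12 * m + 12 * n') * oct_tilde r n' m ((1 + s) / (1 - s))) *
     ((q_v s) ^ 2 / (q_f s) ^ 2)"

end

theory Submission
  imports Defs
begin

text \<open>
  In the variable \<open>s\<close>, with \<open>u = s\<^sup>4\<close>, put \<open>A\<^sub>n(s) = q_v(s)\<^bsup>-2m\<^esup> q_f(s)\<^bsup>-3n/2\<^esup> r\<^sup>m\<^sub>n(s\<^sup>4)\<close> and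
  \<open>B\<^sub>n(s) = s A\<^sub>n(1/s)\<close>. The contiguous relations \<open>n \<rightarrow> n \<plusminus> 1\<close> of the Gauss function become a
  first-order system that is preserved, up to the sign \<open>(-1)\<^sup>n\<close>, by the rotations of the octahedron.
  Comparing at \<open>n = 0\<close>, where \<open>r\<^sup>m\<^sub>n\<close> is explicit, gives
  \<open>(1+s) A\<^sub>n((1-s)/(1+s)) = (-1)\<^bsup>n+m\<^esup> (A\<^sub>n(s) + B\<^sub>n(s))\<close> for all \<open>n\<close>; hence the second factor of the
  integrand is a constant times \<open>A\<^sub>k - B\<^sub>k\<close>, where \<open>k = n'\<close>.

  The system also implies \<open>X'' = (\<dots> - 144 n(3n+2) q_v\<^sup>2/q_f\<^sup>2) X\<close> for \<open>X = A\<^sub>n, B\<^sub>n\<close>, with a remaining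
  part independent of \<open>n\<close>. So the integrand is a constant multiple of the derivative of the Wronskian of
  \<open>A\<^sub>n\<close> and \<open>A\<^sub>k - B\<^sub>k\<close>, and the integral vanishes because this Wronskian has the same limit at
  both ends: the rotation \<open>s \<mapsto> (1-s)/(1+s)\<close> carries the end \<open>1\<close> to \<open>0\<close>, and the Wronskians of
  \<open>A\<^sub>n, A\<^sub>k\<close> and of \<open>B\<^sub>n, B\<^sub>k\<close> tend to \<open>0\<close> there. The two signs agree since \<open>n - k\<close> is even.
\<close>

subsection \<open>Contiguous relations of the Gauss function\<close>

text \<open>Count \<open>q_v\<close>, \<open>q_f\<close> and \<open>p_e (s ^ 4)\<close> as binary
  forms of degrees 6, 8, 12 and the unknown \<open>X\<close> as one of degree 1. Every term of the
  system then has degree 13: \<open>q_f\<close> to the power 3/2 times \<open>X\<close>,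
  \<open>p_e (s ^ 4)\<close> times \<open>X\<close>, and the Jacobian of \<open>X\<close> with the
  degree 14 form \<open>q_v q_f\<close>. Divided by -56 that Jacobian
  \<open>X (q_v q_f)' - 14 q_v q_f X'\<close> is \<open>q_v q_f X' / 4 - (q_v q_f)' X / 56\<close>;
  hence the constant 56. The map \<open>s -> (1-s)/(1+s)\<close> is a half-turn about an edge
  midpoint: the last two terms change sign relative to the first, and each change of
  \<open>n\<close> by one costs a factor -1.

  The values 0 and -1 of \<open>m\<close> come from the vertex \<open>s = 0\<close>, where
  \<open>A_n\<close> and \<open>B_n\<close> have exponents \<open>-2m\<close> and
  \<open>1+2m\<close>. In a Wronskian of two functions with the same exponent \<open>e\<close> the
  leading terms cancel and a factor \<open>s^4\<close> is gained, so it vanishes at 0 when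
  \<open>e >= -1\<close>; both exponents satisfy this exactly for these two \<open>m\<close>. The
  exponent of \<open>B_n\<close> encodes the growth of \<open>r n m\<close> at infinity, so a degree
  bound must accompany the recursion in \<open>n\<close>.\<close>

lemma hypergeo_2_1_nth:
  "fps_nth (fps_hypergeo [a, b] [c] 1) k =
     pochhammer a k * pochhammer b k / (pochhammer c k * fact k)"
  for a b c :: real
  by simp

text \<open>The ratio of consecutive coefficients tends to 1, hence is eventually at most 2, and the
  series converges at 1/3. Some positive radius is enough for the sequel, which evaluates the series
  near \<open>oct_R 0 = 0\<close>.\<close>

lemma fps_conv_radius_hypergeo_2_1:
  fixes a b c :: real
  assumes c: "\<And>k::nat. c \<noteq> - real k"
  shows "fps_conv_radius (fps_hypergeo [a, b] [c] 1) > 0"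
proof -
  let ?h = "\<lambda>k. pochhammer a k * pochhammer b k / (pochhammer c k * fact k)"
  have rec: "?h (Suc k) = ((a + k) * (b + k) / ((c + k) * (1 + k))) * ?h k" for k
    using c[of k] by (simp add: pochhammer_Suc field_simps)
  have "(\<lambda>k. (a + real k) * (b + real k) / ((c + real k) * (1 + real k))) \<longlonglongrightarrow> 1"
  proof -
    have *: "(\<lambda>k. (x + real k) / (y + real k)) \<longlonglongrightarrow> 1" for x y :: real
    proof -
      have "filterlim (\<lambda>k. y + real k) at_top sequentially"
        by (intro filterlim_tendsto_add_at_top[OF tendsto_const] filterlim_real_sequentially)
      hence "(\<lambda>k. (x - y) / (y + real k)) \<longlonglongrightarrow> 0"
        by (intro real_tendsto_divide_at_top[OF tendsto_const])
      hence "(\<lambda>k. 1 + (x - y) / (y + real k)) \<longlonglongrightarrow> 1 + 0"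
        by (intro tendsto_add tendsto_const)
      moreover have "\<forall>\<^sub>F k in sequentially. 1 + (x - y) / (y + real k) = (x + real k) / (y + real k)"
        using eventually_gt_at_top[of "nat \<lceil>- y\<rceil>"]
      proof eventually_elim
        case (elim k)
        hence "y + real k > 0" by linarith
        thus ?case by (simp add: field_simps)
      qed
      ultimately show ?thesis by (auto intro: Lim_transform_eventually)
    qed
    from tendsto_mult[OF *[of a c] *[of b 1]] show ?thesis by simp
  qed
  hence "\<forall>\<^sub>F k in sequentially. dist ((a + real k) * (b + real k) / ((c + real k) * (1 + real k))) 1 < 1"
    by (rule tendstoD) auto
  then obtain N where *: "\<And>k. k \<ge> N \<Longrightarrow>
      dist ((a + real k) * (b + real k) / ((c + real k) * (1 + real k))) 1 < 1"
    by (auto simp: eventually_sequentially)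
  hence N: "\<bar>(a + real k) * (b + real k) / ((c + real k) * (1 + real k))\<bar> \<le> 2"
    if "k \<ge> N" for k
  proof -
    have **: "\<bar>x\<bar> \<le> 2" if "dist x 1 < 1" for x :: real
      using that by (simp add: dist_real_def)
    show ?thesis by (rule **[OF *[OF that]])
  qed
  have "summable (\<lambda>k. ?h k * (1/3) ^ k)"
  proof (rule summable_ratio_test[of "2/3" N])
    fix k assume "k \<ge> N"
    have "norm (?h (Suc k) * (1/3) ^ Suc k) =
        \<bar>(a + k) * (b + k) / ((c + k) * (1 + k))\<bar> * \<bar>?h k\<bar> * (1/3) ^ Suc k"
      unfolding rec by (simp add: abs_mult power_abs)
    also have "\<dots> \<le> 2 * \<bar>?h k\<bar> * (1/3) ^ Suc k"
      using N[OF \<open>k \<ge> N\<close>] by (intro mult_right_mono) simp_all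
    also have "\<dots> = 2/3 * norm (?h k * (1/3) ^ k)"
      by (simp add: abs_mult power_abs)
    finally show "norm (?h (Suc k) * (1/3) ^ Suc k) \<le> 2/3 * norm (?h k * (1/3) ^ k)" .
  qed simp
  hence "conv_radius ?h \<ge> norm (1/3 :: real)"
    by (rule conv_radius_geI)
  moreover have "fps_conv_radius (fps_hypergeo [a, b] [c] 1) = conv_radius ?h"
    unfolding fps_conv_radius_def by (rule arg_cong[where f = conv_radius]) auto
  ultimately show ?thesis
    by (metis ereal_less(2) less_le_trans norm_divide norm_one zero_less_divide_1_iff
        zero_less_norm_iff zero_neq_numeral)
qed

text \<open>Gauss's relation holds coefficientwise: once everything is expressed through the
  coefficient \<open>y\<close> of index \<open>j\<close>, it is a rational identity in
  \<open>a\<close>, \<open>b\<close>, \<open>c\<close>, \<open>j\<close>. Lowering \<open>b\<close>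
  becomes the step from \<open>n\<close> to \<open>n + 1\<close>.\<close>

lemma fps_hypergeo_contiguous_down:
  fixes a b c :: real
  assumes c: "\<And>k::nat. c \<noteq> - real k"
  shows "fps_const (c - b) * fps_hypergeo [a, b - 1] [c] 1 =
    fps_X * fps_deriv (fps_hypergeo [a, b] [c] 1) -
    fps_X * (fps_X * fps_deriv (fps_hypergeo [a, b] [c] 1)) +
    (fps_const (c - b) * fps_hypergeo [a, b] [c] 1 -
      fps_const a * (fps_X * fps_hypergeo [a, b] [c] 1))"
proof (rule fps_ext)
  fix k
  show "fps_nth (fps_const (c - b) * fps_hypergeo [a, b - 1] [c] 1) k = fps_nth (
    fps_X * fps_deriv (fps_hypergeo [a, b] [c] 1) -
    fps_X * (fps_X * fps_deriv (fps_hypergeo [a, b] [c] 1)) +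
    (fps_const (c - b) * fps_hypergeo [a, b] [c] 1 -
      fps_const a * (fps_X * fps_hypergeo [a, b] [c] 1))) k"
  proof (cases k)
    case 0
    then show ?thesis by simp
  next
    case (Suc j)
    define A where "A = pochhammer a j"
    define B where "B = pochhammer b j"
    define C where "C = pochhammer c j"
    define F where "F = (fact j :: real)"
    have nz: "C \<noteq> 0" "F \<noteq> 0" "c + real j \<noteq> 0" "1 + real j \<noteq> 0"
      using c[of j] c by (auto simp: C_def F_def pochhammer_eq_0_iff eq_neg_iff_add_eq_0)
    have b1: "pochhammer (b - 1) (Suc j) = (b - 1) * B"
      by (simp add: pochhammer_rec B_def)
    have tail: "fps_nth (fps_X * (fps_X * fps_deriv (fps_hypergeo [a, b] [c] 1))) (Suc j) =
        real j * (A * B / (C * F))"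
    proof -
      have "fps_nth (fps_hypergeo [a, b] [c] 1) j = A * B / (C * F)"
        by (simp add: A_def B_def C_def F_def)
      thus ?thesis by (cases j) (simp_all del: fps_hypergeo_nth)
    qed
    define y where "y = A * B / (C * F)"
    have y: "fps_nth (fps_hypergeo [a, b] [c] 1) j = y"
      by (simp add: y_def A_def B_def C_def F_def)
    have ySuc: "fps_nth (fps_hypergeo [a, b] [c] 1) (Suc j) =
        y * ((a + j) * (b + j)) / ((c + j) * (1 + j))"
      using nz by (simp add: y_def pochhammer_Suc flip: A_def B_def C_def F_def)
        (simp add: field_simps)
    have yl: "fps_nth (fps_hypergeo [a, b - 1] [c] 1) (Suc j) =
        y * ((a + j) * (b - 1)) / ((c + j) * (1 + j))"
      unfolding hypergeo_2_1_nth b1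
      using nz by (simp add: y_def pochhammer_Suc mult_ac flip: A_def C_def F_def)
    have "(c - b) * (y * ((a + j) * (b - 1)) / ((c + j) * (1 + j))) =
        (1 + real j) * (y * ((a + j) * (b + j)) / ((c + j) * (1 + j))) - real j * y +
        ((c - b) * (y * ((a + j) * (b + j)) / ((c + j) * (1 + j))) - a * y)"
      using nz(3,4) by (simp add: divide_simps) algebra
    thus ?thesis
      unfolding Suc fps_add_nth fps_sub_nth tail[unfolded y_def[symmetric]]
      by (simp del: fps_hypergeo_nth add: y ySuc yl)
  qed
qed

text \<open>The operator \<open>x d/dx\<close> multiplies the coefficient of index \<open>k\<close>
  by \<open>k\<close>, and \<open>a * pochhammer (a + 1) k = (a + k) * pochhammer a k\<close>.
  Raising \<open>a\<close> becomes the step from \<open>n\<close> to \<open>n - 1\<close>.\<close>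

lemma fps_hypergeo_contiguous_up:
  fixes a b c :: real
  shows "fps_const a * fps_hypergeo [a + 1, b] [c] 1 =
    fps_X * fps_deriv (fps_hypergeo [a, b] [c] 1) + fps_const a * fps_hypergeo [a, b] [c] 1"
proof (rule fps_ext)
  fix k
  have "a * pochhammer (a + 1) k = pochhammer a k * (a + k)"
    by (metis pochhammer_Suc pochhammer_rec mult.commute)
  hence "a * (pochhammer (a + 1) k * X) = pochhammer a k * (a + k) * X" for X
    by (metis mult.assoc)
  from this[of "pochhammer b k / (pochhammer c k * fact k)"]
  show "fps_nth (fps_const a * fps_hypergeo [a + 1, b] [c] 1) k =
    fps_nth (fps_X * fps_deriv (fps_hypergeo [a, b] [c] 1) +
      fps_const a * fps_hypergeo [a, b] [c] 1) k"
    by (cases k) (auto simp: algebra_simps add_divide_distrib)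
qed

text \<open>Functions with the same power series expansion agree near 0, so the two formal relations
  turn into pointwise ones, derivative included.\<close>

lemma eventually_hyp2F1:
  fixes a b c :: real
  assumes c: "\<And>k::nat. c \<noteq> - real k"
  shows "\<forall>\<^sub>F x in nhds 0. hyp2F1 a b c differentiable at x \<and>
    (c - b) * hyp2F1 a (b - 1) c x =
      x * (1 - x) * deriv (hyp2F1 a b c) x + (c - b - a * x) * hyp2F1 a b c x \<and>
    a * hyp2F1 (a + 1) b c x = x * deriv (hyp2F1 a b c) x + a * hyp2F1 a b c x"
proof -
  let ?F = "\<lambda>a b. fps_hypergeo [a, b] [c] (1::real)"
  have eq: "hyp2F1 a b c = eval_fps (?F a b)" for a b
    by (simp add: hyp2F1_def fun_eq_iff)
  have F: "hyp2F1 a b c has_fps_expansion ?F a b" for a b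
    unfolding eq
    by (rule eval_fps_has_fps_expansion[OF fps_conv_radius_hypergeo_2_1[OF c]])
  have D: "deriv (hyp2F1 a b c) has_fps_expansion fps_deriv (?F a b)"
    by (rule has_fps_expansion_deriv[OF F])
  have e: "\<forall>\<^sub>F x in nhds 0. f x = g x"
    if "f has_fps_expansion G" "g has_fps_expansion G" for f g :: "real \<Rightarrow> real" and G
    using that unfolding has_fps_expansion_def by (auto elim: eventually_elim2)
  have 1: "\<forall>\<^sub>F x in nhds 0. (c - b) * hyp2F1 a (b - 1) c x =
      x * deriv (hyp2F1 a b c) x - x * (x * deriv (hyp2F1 a b c) x) +
      ((c - b) * hyp2F1 a b c x - a * (x * hyp2F1 a b c x))"
    by (rule e[OF has_fps_expansion_cmult_left[OF F]])
       (unfold fps_hypergeo_contiguous_down[OF c], intro fps_expansion_intros F D)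
  have 2: "\<forall>\<^sub>F x in nhds 0. a * hyp2F1 (a + 1) b c x =
      x * deriv (hyp2F1 a b c) x + a * hyp2F1 a b c x"
    by (rule e[OF has_fps_expansion_cmult_left[OF F]])
       (unfold fps_hypergeo_contiguous_up, intro fps_expansion_intros F D)
  have "eventually (\<lambda>x. x \<in> eball 0 (fps_conv_radius (?F a b))) (nhds 0)"
    by (intro eventually_nhds_in_open) (use fps_conv_radius_hypergeo_2_1[OF c] in \<open>auto simp: zero_ereal_def\<close>)
  hence 3: "\<forall>\<^sub>F x in nhds 0. hyp2F1 a b c differentiable at x"
  proof eventually_elim
    case (elim x)
    hence "norm x < fps_conv_radius (?F a b)" by (simp add: in_eball_iff)
    thus ?case
      unfolding eq
      using has_field_derivative_eval_fps real_differentiable_def by blast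
  qed
  from 1 2 3 show ?thesis
    by eventually_elim (auto simp: algebra_simps)
qed

subsection \<open>Contiguous relations of the octahedral functions\<close>

definition oct_a :: "int \<Rightarrow> int \<Rightarrow> real" where
  "oct_a m n = - 1 / 24 - of_int m / 2 - of_int n / 2"

text \<open>This is \<open>c - b\<close> for the Gauss parameters
  \<open>b = oct_a m n + 1 / 2\<close> and \<open>c = 3 / 4 - m\<close>: the factor that the
  relation lowering \<open>b\<close> puts in front of the new function.\<close>

definition oct_k :: "int \<Rightarrow> int \<Rightarrow> real" where
  "oct_k m n = 7 / 24 - of_int m / 2 + of_int n / 2"

text \<open>\<open>- 24 * oct_a m n\<close> and \<open>24 * oct_k m n\<close> are integers congruent
  to 1 and 7 modulo 12. So the contiguous relations can be solved for both neighbours at every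
  \<open>n\<close>, and the recursion never breaks off.\<close>

lemma oct_a_nonzero: "oct_a m n \<noteq> 0"
proof
  assume "oct_a m n = 0"
  hence "real_of_int (1 + 12 * m + 12 * n) = 0" by (simp add: oct_a_def)
  hence "1 + 12 * m + 12 * n = 0" by linarith
  thus False by presburger
qed

lemma oct_k_nonzero: "oct_k m n \<noteq> 0"
proof
  assume "oct_k m n = 0"
  hence "real_of_int (7 - 12 * m + 12 * n) = 0" by (simp add: oct_k_def)
  hence "7 - 12 * m + 12 * n = 0" by linarith
  thus False by presburger
qed

lemma c_param_not_nonpos_int: "3 / 4 - real_of_int m \<noteq> - real k"
proof
  assume "3 / 4 - real_of_int m = - real k"
  hence "real_of_int (3 - 4 * m + 4 * int k) = 0" by simp
  hence "3 - 4 * m + 4 * int k = 0" by linarith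
  thus False by presburger
qed

lemma DERIV_p_e: "(p_e has_real_derivative (- 33 - 66 * u + 3 * u ^ 2)) (at u)"
  unfolding p_e_def by (auto intro!: derivative_eq_intros simp: algebra_simps power2_eq_square)

lemma DERIV_p_f: "(p_f has_real_derivative (14 + 2 * u)) (at u)"
  unfolding p_f_def by (auto intro!: derivative_eq_intros)

lemma DERIV_p_v: "(p_v has_real_derivative ((1 - u) ^ 3 * (1 - 5 * u))) (at u)"
  unfolding p_v_def
  by (auto intro!: derivative_eq_intros simp: algebra_simps power2_eq_square power3_eq_cube power4_eq_xxxx)

text \<open>\<open>oct_R\<close> is a Belyi map, ramified only over 0, 1 and infinity. The factors
  of its derivative reflect the fourfold zero at \<open>u = 1\<close>, the triple zeros of
  \<open>1 - oct_R\<close> at the roots of \<open>p_f\<close>, and the double poles at the roots of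
  \<open>p_e\<close>.\<close>

lemma DERIV_oct_R:
  assumes "p_e u \<noteq> 0"
  shows "(oct_R has_real_derivative (- 108 * (1 - u) ^ 3 * p_f u ^ 2 / p_e u ^ 3)) (at u)"
proof -
  have "(oct_R has_real_derivative
      - 108 * ((1 - u) ^ 3 * (1 - 5 * u) * p_e u ^ 2 - p_v u * (2 * p_e u * (- 33 - 66 * u + 3 * u ^ 2)))
        / (p_e u ^ 2 * p_e u ^ 2)) (at u)"
    unfolding oct_R_def using assms
    by (intro DERIV_cong[OF DERIV_divide[OF DERIV_cmult[OF DERIV_p_v] DERIV_power[OF DERIV_p_e]]])
       (simp_all add: algebra_simps)
  also have "(1 - u) ^ 3 * (1 - 5 * u) * p_e u ^ 2 - p_v u * (2 * p_e u * (- 33 - 66 * u + 3 * u ^ 2))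
      = p_e u * ((1 - u) ^ 3 * p_f u ^ 2)"
    unfolding p_e_def p_v_def p_f_def by algebra
  finally show ?thesis
    using assms by (simp add: power2_eq_square power3_eq_cube mult.assoc)
qed

lemma octahedral_function_alt:
  "octahedral_function n m f \<longleftrightarrow> rational_fun f \<and>
     (\<forall>\<^sub>F u in nhds 0. hyp2F1 (oct_a m n) (oct_a m n + 1 / 2) (3 / 4 - of_int m) (oct_R u) =
        p_e u powr (2 * oct_a m n) * f u)"
proof -
  have 1: "11 / 24 - of_int m / 2 - of_int n / 2 = oct_a m n + 1 / 2"
   and 2: "- 1 / 12 - of_int m - of_int n = 2 * oct_a m n"
    by (simp_all add: oct_a_def field_simps)
  show ?thesis
    unfolding octahedral_function_def 1 2 oct_a_def[symmetric] ..
qed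

lemma hyp2F1_commute: "hyp2F1 a b c = hyp2F1 b a c"
  by (rule ext) (simp add: hyp2F1_series mult.commute)

text \<open>The upper Gauss parameters are \<open>a\<close> and \<open>a + 1 / 2\<close>. Changing
  \<open>n\<close> by one shifts both by a half, which after exchanging them is an integer shift of
  only one: \<open>{a - 1/2, a}\<close> arises by lowering \<open>a + 1/2\<close>, and
  \<open>{a + 1/2, a + 1}\<close> by raising \<open>a\<close>. So a single contiguous relation is
  enough in each direction.\<close>

lemma octahedral_contiguous_near_0:
  assumes f: "octahedral_function n m f"
      and fu: "octahedral_function (n + 1) m fu"
      and fd: "octahedral_function (n - 1) m fd"
  shows "\<forall>\<^sub>F u in nhds 0. f differentiable (at u) \<and>
     oct_k m n * fu u = (oct_k m n * p_e u + 6 * oct_a m n * u * (1 - u) * (u + 7)) * f u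
        + u * (1 - u) * p_f u * deriv f u \<and>
     oct_a m n * p_f u ^ 2 * fd u = oct_a m n * (1 - 5 * u) * f u + u * (1 - u) * deriv f u"
proof -
  define a where "a = oct_a m n"
  define c :: real where "c = 3 / 4 - of_int m"
  define k where "k = oct_k m n"
  define F where "F = hyp2F1 a (a + 1 / 2) c"
  have k: "k = c - (a + 1 / 2)"
    by (simp add: k_def c_def a_def oct_k_def oct_a_def)
  have aS: "oct_a m (n + 1) = a - 1 / 2" and aP: "oct_a m (n - 1) = a + 1 / 2"
    by (simp_all add: a_def oct_a_def field_simps)
  have cn: "c \<noteq> - real j" for j :: nat
    unfolding c_def by (rule c_param_not_nonpos_int)
  have R0: "isCont oct_R 0" "oct_R 0 = 0"
    using DERIV_isCont[OF DERIV_oct_R[of 0]] by (auto simp: p_e_def oct_R_def p_v_def)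
  hence "filterlim oct_R (nhds 0) (nhds 0)"
    using tendsto_at_iff_tendsto_nhds[of oct_R 0] by (simp add: isCont_def)
  have evR: "\<forall>\<^sub>F u in nhds 0. P (oct_R u)" if "\<forall>\<^sub>F x in nhds 0. P x" for P
    using that \<open>filterlim oct_R (nhds 0) (nhds 0)\<close> by (simp add: filterlim_iff)
  have evE: "\<forall>\<^sub>F u in nhds 0. p_e u > 0"
  proof -
    have "isCont p_e 0" by (rule DERIV_isCont[OF DERIV_p_e])
    hence "(p_e \<longlongrightarrow> p_e 0) (nhds 0)"
      using tendsto_at_iff_tendsto_nhds[of p_e 0] by (simp add: isCont_def)
    thus ?thesis
      by (rule order_tendstoD) (simp add: p_e_def)
  qed
  have ev0: "\<forall>\<^sub>F u in nhds 0. F (oct_R u) = p_e u powr (2 * a) * f u"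
    using f unfolding octahedral_function_alt F_def a_def c_def by simp
  have "\<forall>\<^sub>F u in nhds 0. p_e u > 0 \<and> F (oct_R u) = p_e u powr (2 * a) * f u"
    using evE ev0 by eventually_elim auto
  \<comment> \<open>The defining identity is differentiated at \<open>u\<close>, so it must hold on
    a neighbourhood of \<open>u\<close> and not only at \<open>u\<close>.\<close>
  hence evf: "\<forall>\<^sub>F u in nhds 0. \<forall>\<^sub>F v in nhds u.
      p_e v > 0 \<and> F (oct_R v) = p_e v powr (2 * a) * f v"
    by (simp add: eventually_eventually)
  have evu: "\<forall>\<^sub>F u in nhds 0. hyp2F1 a (a + 1 / 2 - 1) c (oct_R u) = p_e u powr (2 * a - 1) * fu u"
  proof -
    have "hyp2F1 a (a + 1 / 2 - 1) c = hyp2F1 (a - 1 / 2) (a - 1 / 2 + 1 / 2) c"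
      by (subst hyp2F1_commute) simp
    thus ?thesis
      using fu unfolding octahedral_function_alt aS c_def by (simp add: algebra_simps)
  qed
  have evd: "\<forall>\<^sub>F u in nhds 0. hyp2F1 (a + 1) (a + 1 / 2) c (oct_R u) = p_e u powr (2 * a + 1) * fd u"
  proof -
    have "hyp2F1 (a + 1) (a + 1 / 2) c = hyp2F1 (a + 1 / 2) (a + 1 / 2 + 1 / 2) c"
      by (subst hyp2F1_commute) (simp add: add.commute)
    thus ?thesis
      using fd unfolding octahedral_function_alt aP c_def by (simp add: algebra_simps)
  qed
  show ?thesis
    using evf evu evd evR[OF eventually_hyp2F1[OF cn, of a "a + 1 / 2"]]
    unfolding F_def[symmetric] a_def[symmetric] k_def[symmetric] k[symmetric]
  proof eventually_elim
    case (elim u)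
    \<comment> \<open>With this \<open>E\<close> the three functions are \<open>E\<close>,
      \<open>E * p_e u\<close> and \<open>E * p_e u ^ 2\<close> times Gauss values, and only integer
      powers of \<open>p_e u\<close> are left to compare.\<close>
    define E where "E = p_e u powr (- (2 * a) - 1)"
    define R where "R = oct_R u"
    define G where "G = deriv F R"
    from eventually_nhds_x_imp_x[OF elim(1)] have pos: "p_e u > 0" by simp
    have E: "p_e u powr - (2 * a) = E * p_e u"
      using pos powr_add[of "p_e u" "- (2 * a) - 1" 1] by (simp add: E_def)
    have inv: "p_e v powr - (2 * a) * (p_e v powr (2 * a) * y) = y" if "p_e v > 0" for v y
      using that by (simp add: powr_minus field_simps)
    have loc: "\<forall>\<^sub>F v in nhds u. p_e v powr - (2 * a) * F (oct_R v) = f v"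
      using elim(1) by eventually_elim (use inv in auto)
    have fu: "f u = E * p_e u * F R"
      using eventually_nhds_x_imp_x[OF loc] by (simp add: E R_def)
    have fuu: "fu u = E * p_e u ^ 2 * hyp2F1 a (a + 1 / 2 - 1) c R"
    proof -
      have "E * p_e u ^ 2 = p_e u powr (1 - 2 * a)"
        using pos E powr_add[of "p_e u" "- (2 * a)" 1] by (simp add: power2_eq_square algebra_simps)
      moreover have "p_e u powr (1 - 2 * a) * p_e u powr (2 * a - 1) = 1"
        using pos by (simp flip: powr_add)
      ultimately show ?thesis
        using elim(2) by (simp add: R_def flip: mult.assoc)
    qed
    have fdu: "fd u = E * hyp2F1 (a + 1) (a + 1 / 2) c R"
    proof -
      have "E * p_e u powr (2 * a + 1) = 1"
        using pos by (simp add: E_def flip: powr_add)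
      thus ?thesis
        using elim(3) by (simp add: R_def flip: mult.assoc)
    qed
    have DF: "(F has_real_derivative G) (at R)"
      using elim(4) by (simp add: R_def G_def DERIV_deriv_iff_real_differentiable)
    define f' where "f' = - 2 * a * E * (- 33 - 66 * u + 3 * u ^ 2) * F R +
       E * p_e u * G * (- 108 * (1 - u) ^ 3 * p_f u ^ 2 / p_e u ^ 3)"
    have "((\<lambda>v. p_e v powr - (2 * a) * F (oct_R v)) has_real_derivative f') (at u)"
      using pos DF unfolding f'_def R_def
      by (auto intro!: derivative_eq_intros DERIV_p_e DERIV_fun_powr DERIV_chain2[OF DF[unfolded R_def] DERIV_oct_R]
          simp: E_def[symmetric] E[simplified])
    hence Df: "(f has_real_derivative f') (at u)"
      using DERIV_cong_ev[OF refl loc refl] by blast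
    have d: "deriv f u = f'" by (rule DERIV_imp_deriv[OF Df])
    have hup: "k * hyp2F1 a (a + 1 / 2 - 1) c R = R * (1 - R) * G + (k - a * R) * F R"
      and hdn: "a * hyp2F1 (a + 1) (a + 1 / 2) c R = R * G + a * F R"
      using elim(4) by (auto simp: R_def G_def)
    have R: "R = - 108 * p_v u / p_e u ^ 2" "1 - R = p_f u ^ 3 / p_e u ^ 2"
      using pos oct_R_alt[of u] by (simp_all add: R_def oct_R_def)
    have "k * fu u = E * p_e u ^ 2 * (R * (1 - R) * G) + E * (p_e u ^ 2 * k - a * (R * p_e u ^ 2)) * F R"
      unfolding fuu using hup by algebra
    also have "R * p_e u ^ 2 = - 108 * p_v u" using pos R by simp
    also have "E * p_e u ^ 2 * (R * (1 - R) * G) = u * (1 - u) * p_f u *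
       (E * p_e u * G * (- 108 * (1 - u) ^ 3 * p_f u ^ 2 / p_e u ^ 3))"
      using pos unfolding R(2) unfolding R(1) by (simp add: p_v_def divide_simps) algebra
    finally have 1: "k * fu u = (k * p_e u + 6 * a * u * (1 - u) * (u + 7)) * f u
        + u * (1 - u) * p_f u * f'"
      unfolding f'_def fu p_e_def p_v_def p_f_def by algebra
    have "a * p_f u ^ 2 * fd u = E * (p_f u ^ 2 * R * G) + E * a * p_f u ^ 2 * F R"
      unfolding fdu using hdn by algebra
    also have "E * (p_f u ^ 2 * R * G) = u * (1 - u) * 
       (E * p_e u * G * (- 108 * (1 - u) ^ 3 * p_f u ^ 2 / p_e u ^ 3))"
      using pos unfolding R(1) by (simp add: p_v_def divide_simps) algebra
    finally have 2: "a * p_f u ^ 2 * fd u = a * (1 - 5 * u) * f u + u * (1 - u) * f'"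
      unfolding f'_def fu p_e_def p_v_def p_f_def by algebra
    from 1 2 Df show ?case
      unfolding d using real_differentiable_def by blast
  qed
qed

lemma octahedral_function_at_0:
  assumes "octahedral_function n m f"
  shows "f 0 = 1"
proof -
  have "hyp2F1 (oct_a m n) (oct_a m n + 1 / 2) (3 / 4 - of_int m) (oct_R 0) =
        p_e 0 powr (2 * oct_a m n) * f 0"
    using assms eventually_nhds_x_imp_x unfolding octahedral_function_alt by blast
  thus ?thesis
    by (simp add: oct_R_def p_v_def p_e_def hyp2F1_def eval_fps_at_0)
qed

section \<open>Continuation of identities between rational functions, and the recursion in
  \<open>n\<close>\<close>

lemma infinite_if_eventually_at_right:
  fixes a :: real
  assumes "\<forall>\<^sub>F x in at_right a. P x"
  shows "infinite {x. P x}"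
proof -
  obtain b where "b > a" "\<And>x. a < x \<Longrightarrow> x < b \<Longrightarrow> P x"
    using assms unfolding eventually_at_right_field by auto
  hence "{a<..<b} \<subseteq> {x. P x}" "infinite {a<..<b}" by (auto simp: infinite_Ioo)
  thus ?thesis using finite_subset by blast
qed

text \<open>After clearing denominators, a polynomial identity holds at infinitely many points,
  hence everywhere; the additional factor \<open>Q\<close> takes care of poles of \<open>f\<close>
  among these points. In lowest terms \<open>Q\<close> cannot vanish where \<open>d\<close> does
  not, so the value at \<open>x\<close> is the right one.\<close>

lemma rational_fun_eqI:
  assumes f: "rational_fun f"
      and ev: "\<forall>\<^sub>F u in at_right a. f u * poly d u = poly p u"
      and nz: "poly d x \<noteq> 0"
  shows "f x = poly p x / poly d x"
proof -
  obtain P Q where Q: "Q \<noteq> 0" "coprime P Q" and f: "\<And>u. f u = poly P u / poly Q u"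
    using f unfolding rational_fun_def by auto
  have "\<forall>\<^sub>F u in at_right a. poly ((P * d - p * Q) * Q) u = 0"
    using ev
  proof eventually_elim
    case (elim u)
    thus ?case by (cases "poly Q u = 0") (auto simp: f field_simps)
  qed
  hence "infinite {u. poly ((P * d - p * Q) * Q) u = 0}"
    by (rule infinite_if_eventually_at_right)
  hence "(P * d - p * Q) * Q = 0"
    using poly_roots_finite by blast
  hence "P * d = p * Q" using Q by simp
  hence eq: "poly P x * poly d x = poly p x * poly Q x"
    by (metis poly_mult)
  have "poly Q x \<noteq> 0"
    using eq nz coprime_poly_0[OF Q(2), of x] by auto
  with eq nz show ?thesis by (simp add: f field_simps)
qed

lemma poly_oct:
  "poly [:1, -33, -33, 1:] u = p_e u"
  "poly [:1, 14, 1:] u = p_f u"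
  by (simp_all add: p_e_def p_f_def algebra_simps power2_eq_square)

lemma poly_denominator:
  "poly ([:1, 14, 1:] ^ k * [:1, -1:] ^ j) u = p_f u ^ k * (1 - u) ^ j"
  by (simp only: poly_mult poly_power poly_oct) simp

lemma p_f_nonzero_pos: "u \<ge> 0 \<Longrightarrow> p_f u > 0"
  by (simp add: p_f_def add_pos_nonneg)

lemma open_nonsingular: "open {u. p_f u \<noteq> 0 \<and> u \<noteq> 1}"
  unfolding p_f_def
  by (intro open_Collect_conj open_Collect_neq continuous_intros)

text \<open>The relations near 0 give both neighbours as explicit rational functions, and
  \<open>rational_fun_eqI\<close> carries this to all \<open>u\<close> with \<open>p_f u\<close>
  nonzero and \<open>u\<close> different from 1. The degrees are recorded for the later control at
  infinity.\<close>

lemma octahedral_step: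
  fixes r :: "int \<Rightarrow> int \<Rightarrow> real \<Rightarrow> real" and p :: "real poly"
  assumes oct: "\<And>n m. octahedral_function n m (r n m)"
      and form: "\<And>u. p_f u \<noteq> 0 \<Longrightarrow> u \<noteq> 1 \<Longrightarrow> r n m u = poly p u / (p_f u ^ k * (1 - u) ^ j)"
  obtains pu pd where
    "degree pu \<le> degree p + 3"
    "\<And>u. p_f u \<noteq> 0 \<Longrightarrow> u \<noteq> 1 \<Longrightarrow> r (n + 1) m u = poly pu u / (p_f u ^ k * (1 - u) ^ j)"
    "degree pd \<le> degree p + 3"
    "\<And>u. p_f u \<noteq> 0 \<Longrightarrow> u \<noteq> 1 \<Longrightarrow> r (n - 1) m u = poly pd u / (p_f u ^ (k + 3) * (1 - u) ^ j)"
    "\<And>u. p_f u \<noteq> 0 \<Longrightarrow> u \<noteq> 1 \<Longrightarrow> \<exists>d. (r n m has_real_derivative d) (at u) \<and>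
       oct_k m n * r (n + 1) m u =
         (oct_k m n * p_e u + 6 * oct_a m n * u * (1 - u) * (u + 7)) * r n m u + u * (1 - u) * p_f u * d \<and>
       oct_a m n * p_f u ^ 2 * r (n - 1) m u = oct_a m n * (1 - 5 * u) * r n m u + u * (1 - u) * d"
proof -
  define K a where "K = oct_k m n" and "a = oct_a m n"
  have K: "K \<noteq> 0" and a: "a \<noteq> 0"
    by (simp_all add: K_def a_def oct_k_nonzero oct_a_nonzero)
  define D where "D = degree p"
  \<comment> \<open>\<open>N\<close> is the numerator of the derivative of \<open>r n m\<close> over
    the denominator \<open>p_f u ^ (k + 1) * (1 - u) ^ (j + 1)\<close>.\<close>
  define N where "N = pderiv p * ([:1, 14, 1:] * [:1, -1:])
      - smult (real k) (p * ([:14, 2:] * [:1, -1:])) + smult (real j) (p * [:1, 14, 1:])"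
  define pu where "pu = p * [:1, -33, -33, 1:] +
      smult (6 * a / K) (p * [:0, 7, -6, -1:]) + smult (1 / K) (pCons 0 N)"
  define pd where "pd = p * ([:1, 14, 1:] * [:1, -5:]) + smult (1 / a) (pCons 0 N)"
  define d where "d u = poly N u / (p_f u ^ (k + 1) * (1 - u) ^ (j + 1))" for u
  have pN: "poly N u = poly (pderiv p) u * p_f u * (1 - u)
      - k * poly p u * (14 + 2 * u) * (1 - u) + j * poly p u * p_f u" for u
    by (simp add: N_def p_f_def algebra_simps power2_eq_square)
  have ppu: "K * poly pu u = (K * p_e u + 6 * a * u * (1 - u) * (u + 7)) * poly p u + u * poly N u" for u
    using K by (simp add: pu_def p_e_def field_simps power2_eq_square)
  have ppd: "a * poly pd u = a * (1 - 5 * u) * p_f u * poly p u + u * poly N u" for u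
    using a by (simp add: pd_def p_f_def field_simps power2_eq_square)
  have degN: "degree N \<le> D + 2"
  proof -
    \<comment> \<open>For constant \<open>p\<close> the derivative has \<open>degree\<close> 0
      instead of \<open>D - 1\<close>, and the general estimate would lose one.\<close>
    have "degree (pderiv p * ([:1, 14, 1:] * [:1, -1:])) \<le> D + 2"
    proof (cases "D = 0")
      case True
      hence "pderiv p = 0" by (simp add: D_def pderiv_eq_0_iff)
      thus ?thesis by simp
    next
      case False
      have "degree (pderiv p * ([:1, 14, 1:] * [:1, -1:])) \<le> degree (pderiv p) + 3"
        by (rule order_trans[OF degree_mult_le]) simp
      thus ?thesis using False by (simp add: degree_pderiv D_def)
    qed
    moreover have "degree (smult (real k) (p * ([:14, 2:] * [:1, -1:]))) \<le> D + 2"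
      by (rule order_trans[OF degree_smult_le], rule order_trans[OF degree_mult_le]) (simp add: D_def)
    moreover have "degree (smult (real j) (p * [:1, 14, 1:])) \<le> D + 2"
      by (rule order_trans[OF degree_smult_le], rule order_trans[OF degree_mult_le]) (simp add: D_def)
    ultimately show ?thesis
      unfolding N_def by (intro degree_add_le degree_diff_le)
  qed
  have degXN: "degree (smult c (pCons 0 N)) \<le> D + 3" for c
    using degN by (intro order_trans[OF degree_smult_le] order_trans[OF degree_pCons_le]) simp
  have degu: "degree pu \<le> D + 3"
    unfolding pu_def
    by (intro degree_add_le degXN order_trans[OF degree_smult_le] order_trans[OF degree_mult_le])
       (simp_all add: D_def)
  have degd: "degree pd \<le> D + 3"
    unfolding pd_def
    by (intro degree_add_le degXN order_trans[OF degree_mult_le])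
       (simp_all add: D_def)
  have deriv: "(r n m has_real_derivative d u) (at u)" if u: "p_f u \<noteq> 0" "u \<noteq> 1" for u
  proof -
    have "((\<lambda>u. poly p u / (p_f u ^ k * (1 - u) ^ j)) has_real_derivative
        (poly (pderiv p) u * (p_f u ^ k * (1 - u) ^ j) - poly p u * 
          (k * (14 + 2 * u) * p_f u ^ (k - 1) * (1 - u) ^ j + p_f u ^ k * (- (j * (1 - u) ^ (j - 1))))) /
        ((p_f u ^ k * (1 - u) ^ j) * (p_f u ^ k * (1 - u) ^ j))) (at u)"
      using u by (auto intro!: derivative_eq_intros DERIV_p_f poly_DERIV)
    also have "k * (14 + 2 * u) * p_f u ^ (k - 1) * (1 - u) ^ j = p_f u ^ k * (1 - u) ^ j * (k * (14 + 2 * u) / p_f u)"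
      using u by (cases k) (simp_all add: field_simps)
    also have "p_f u ^ k * (- (j * (1 - u) ^ (j - 1))) = p_f u ^ k * (1 - u) ^ j * (- (j / (1 - u)))"
      using u by (cases j) (simp_all add: field_simps)
    also have "(poly (pderiv p) u * (p_f u ^ k * (1 - u) ^ j) - poly p u *
        (p_f u ^ k * (1 - u) ^ j * (k * (14 + 2 * u) / p_f u) + p_f u ^ k * (1 - u) ^ j * (- (j / (1 - u))))) /
        ((p_f u ^ k * (1 - u) ^ j) * (p_f u ^ k * (1 - u) ^ j)) = 
      (poly (pderiv p) u - poly p u * (k * (14 + 2 * u) / p_f u - j / (1 - u))) / (p_f u ^ k * (1 - u) ^ j)"
    proof -
      have *: "(x * z - y * (z * s + z * t)) / (z * z) = (x - y * (s + t)) / z" if "z \<noteq> 0" for x y z s t :: real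
        using that by (simp add: field_simps)
      show ?thesis using u by (subst *) (simp_all del: mult_eq_0_iff add: mult_eq_0_iff)
    qed
    also have "\<dots> = d u"
      using u unfolding d_def pN by (simp add: divide_simps) (simp add: algebra_simps)
    finally show ?thesis
    proof (rule iffD1[OF DERIV_cong_ev[OF refl _ refl], rotated])
      have "\<forall>\<^sub>F v in nhds u. v \<in> {u. p_f u \<noteq> 0 \<and> u \<noteq> 1}"
        using u by (intro eventually_nhds_in_open open_nonsingular) auto
      thus "\<forall>\<^sub>F v in nhds u. poly p v / (p_f v ^ k * (1 - v) ^ j) = r n m v"
        by eventually_elim (simp add: form)
    qed
  qed
  have A: "A * (x / z) + G * (N / (pf * z * w)) = (A * x + u * N) / z"
    if "z \<noteq> 0" "pf \<noteq> 0" "w \<noteq> 0" "G = u * w * pf" for A x z G N pf w u :: real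
    using that by (simp add: field_simps)
  have B: "A * (x / z) + G * (N / (pf * z * w)) = (A * pf * x + u * N) / (pf * z)"
    if "z \<noteq> 0" "pf \<noteq> 0" "w \<noteq> 0" "G = u * w" for A x z G N pf w u :: real
    using that by (simp add: field_simps)
  have d': "d u = poly N u / (p_f u * (p_f u ^ k * (1 - u) ^ j) * (1 - u))" for u
    by (simp add: d_def mult_ac)
  have U: "(K * p_e u + 6 * a * u * (1 - u) * (u + 7)) * r n m u + u * (1 - u) * p_f u * d u =
      K * (poly pu u / (p_f u ^ k * (1 - u) ^ j))" if "p_f u \<noteq> 0" "u \<noteq> 1" for u
    unfolding form[OF that] d' using that by (subst A[where u = u]) (simp_all add: ppu)
  have V: "a * (1 - 5 * u) * r n m u + u * (1 - u) * d u =
      a * p_f u ^ 2 * (poly pd u / (p_f u ^ (k + 3) * (1 - u) ^ j))" if "p_f u \<noteq> 0" "u \<noteq> 1" for u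
    unfolding form[OF that] d' using that
    by (subst B[where u = u]) (simp_all add: ppd[symmetric] power_add power2_eq_square power3_eq_cube)
  have "\<forall>\<^sub>F u in nhds 0. u \<in> {u. p_f u \<noteq> 0 \<and> u \<noteq> 1}"
    by (intro eventually_nhds_in_open open_nonsingular) (auto simp: p_f_def)
  hence near: "\<forall>\<^sub>F u in nhds 0. r (n + 1) m u * poly ([:1, 14, 1:] ^ k * [:1, -1:] ^ j) u = poly pu u \<and>
      r (n - 1) m u * poly ([:1, 14, 1:] ^ (k + 3) * [:1, -1:] ^ j) u = poly pd u"
    using octahedral_contiguous_near_0[OF oct oct oct, of n m]
    unfolding a_def[symmetric] K_def[symmetric]
  proof eventually_elim
    case (elim u)
    hence u: "p_f u \<noteq> 0" "u \<noteq> 1" by auto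
    have "deriv (r n m) u = d u" using deriv[OF u] by (rule DERIV_imp_deriv)
    with elim(2) U[OF u] V[OF u]
    have "K * r (n + 1) m u = K * (poly pu u / (p_f u ^ k * (1 - u) ^ j))"
         "a * p_f u ^ 2 * r (n - 1) m u = a * p_f u ^ 2 * (poly pd u / (p_f u ^ (k + 3) * (1 - u) ^ j))"
      by metis+
    hence "r (n + 1) m u = poly pu u / (p_f u ^ k * (1 - u) ^ j)"
          "r (n - 1) m u = poly pd u / (p_f u ^ (k + 3) * (1 - u) ^ j)"
      unfolding mult_cancel_left using K a u by simp_all
    thus ?case using u unfolding poly_denominator by simp
  qed
  have at_r: "\<forall>\<^sub>F u in at_right 0. P u" if "\<forall>\<^sub>F u in nhds 0. P u" for P :: "real \<Rightarrow> bool"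
    using that by (simp add: eventually_at_filter eventually_mono)
  have rat: "rational_fun (r n m)" for n m
    using oct octahedral_function_alt by blast
  have fu: "r (n + 1) m u = poly pu u / (p_f u ^ k * (1 - u) ^ j)" if u: "p_f u \<noteq> 0" "u \<noteq> 1" for u
    unfolding poly_denominator[symmetric]
    by (rule rational_fun_eqI[OF rat at_r])
       (use near u in \<open>auto simp: poly_denominator elim: eventually_mono simp del: poly_mult poly_power\<close>)
  have fd: "r (n - 1) m u = poly pd u / (p_f u ^ (k + 3) * (1 - u) ^ j)" if u: "p_f u \<noteq> 0" "u \<noteq> 1" for u
    unfolding poly_denominator[symmetric]
    by (rule rational_fun_eqI[OF rat at_r])
       (use near u in \<open>auto simp: poly_denominator elim: eventually_mono simp del: poly_mult poly_power\<close>)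
  show thesis
  proof (rule that)
    fix u assume u: "p_f u \<noteq> 0" "u \<noteq> 1"
    show "\<exists>d. (r n m has_real_derivative d) (at u) \<and>
       oct_k m n * r (n + 1) m u =
         (oct_k m n * p_e u + 6 * oct_a m n * u * (1 - u) * (u + 7)) * r n m u + u * (1 - u) * p_f u * d \<and>
       oct_a m n * p_f u ^ 2 * r (n - 1) m u = oct_a m n * (1 - 5 * u) * r n m u + u * (1 - u) * d"
      using deriv[OF u] U[OF u] V[OF u] fu[OF u] fd[OF u] unfolding K_def a_def by metis
  qed (use degu degd fu fd in \<open>auto simp: D_def\<close>)
qed

section \<open>Closed forms at \<open>n = 0\<close>\<close>

lemma zero_derivative_imp_eq_limit:
  fixes f :: "real \<Rightarrow> real"
  assumes deriv: "\<And>x. a < x \<Longrightarrow> x < b \<Longrightarrow> (f has_real_derivative 0) (at x)"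
      and lim: "(f \<longlongrightarrow> L) (at_right a)" and x: "a < x" "x < b"
  shows "f x = L"
proof -
  have "f y = f x" if "a < y" "y < b" for y
    using that x by (intro DERIV_isconst3[of a b y x f] deriv) simp_all
  hence "\<forall>\<^sub>F y in at_right a. f y = f x"
    using x unfolding eventually_at_right_field by (metis less_trans)
  hence "(f \<longlongrightarrow> f x) (at_right a)"
    by (rule tendsto_eventually)
  from tendsto_unique[OF trivial_limit_at_right_real this lim] show ?thesis .
qed

lemma eventually_nhds_imp_Ico:
  assumes "\<forall>\<^sub>F u in nhds (a :: real). P u"
  obtains b where "b > a" "P a" "\<And>u. a < u \<Longrightarrow> u < b \<Longrightarrow> P u"
proof -
  from assms have "\<forall>\<^sub>F u in at_right a. P u"
    by (simp add: eventually_at_filter eventually_mono)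
  then obtain b where "b > a" "\<forall>y>a. y < b \<longrightarrow> P y"
    unfolding eventually_at_right_field by blast
  with eventually_nhds_x_imp_x[OF assms] show thesis
    by (intro that[of b]) simp_all
qed

text \<open>The cross term \<open>w = y0 h1 - y1 h0\<close> of two solutions satisfies a first-order equation whose solutions
  behave like \<open>u powr (1/4 + m)\<close> at \<open>0\<close>; being differentiable there, it vanishes.\<close>

lemma octahedral_base:
  fixes r :: "int \<Rightarrow> int \<Rightarrow> real \<Rightarrow> real" and h0 h1 :: "real \<Rightarrow> real"
  assumes oct: "\<And>n m. octahedral_function n m (r n m)"
      and m: "m \<le> 0"
      and h0: "\<And>u. 0 \<le> u \<Longrightarrow> u < 1 \<Longrightarrow> (h0 has_real_derivative d0 u) (at u)"
      and h1: "\<And>u. 0 \<le> u \<Longrightarrow> u < 1 \<Longrightarrow> (h1 has_real_derivative d1 u) (at u)"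
      and up: "\<And>u. 0 \<le> u \<Longrightarrow> u < 1 \<Longrightarrow> oct_k m 0 * h1 u =
         (oct_k m 0 * p_e u + 6 * oct_a m 0 * u * (1 - u) * (u + 7)) * h0 u + u * (1 - u) * p_f u * d0 u"
      and dn: "\<And>u. 0 \<le> u \<Longrightarrow> u < 1 \<Longrightarrow> oct_a m 1 * p_f u ^ 2 * h0 u =
         oct_a m 1 * (1 - 5 * u) * h1 u + u * (1 - u) * d1 u"
      and h00: "h0 0 = 1" and h0_nz: "\<And>u. 0 \<le> u \<Longrightarrow> u < 1 \<Longrightarrow> h0 u \<noteq> 0"
  shows "\<forall>\<^sub>F u in at_right 0. r 0 m u = h0 u"
proof -
  define k a a1 :: real where "k = oct_k m 0" and "a = oct_a m 0" and "a1 = oct_a m 1"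
  have k: "k \<noteq> 0" by (simp add: k_def oct_k_nonzero)
  define c :: real where "c = 1 / 4 + of_int m"
  have kc: "k = 7 / 24 - (c - 1 / 4) / 2" "a = - 1 / 24 - (c - 1 / 4) / 2" "a1 = - 13 / 24 - (c - 1 / 4) / 2"
    by (simp_all add: k_def a_def a1_def oct_k_def oct_a_def c_def field_simps)
  define A where "A u = k * p_e u + 6 * a * u * (1 - u) * (u + 7)" for u
  \<comment> \<open>The step up from index 0 and the step down from index 1 form a closed
    first-order system for the pair \<open>y0\<close>, \<open>y1\<close>; the hypotheses say that
    \<open>h0\<close>, \<open>h1\<close> solve the same system.\<close>
  define y0 y1 where "y0 = r 0 m" and "y1 = r 1 m"
  have "\<forall>\<^sub>F u in nhds 0.
     y0 differentiable (at u) \<and> y1 differentiable (at u) \<and>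
     k * y1 u = A u * y0 u + u * (1 - u) * p_f u * deriv y0 u \<and>
     a1 * p_f u ^ 2 * y0 u = a1 * (1 - 5 * u) * y1 u + u * (1 - u) * deriv y1 u"
    using octahedral_contiguous_near_0[OF oct oct oct, of 0 m]
      octahedral_contiguous_near_0[OF oct oct oct, of 1 m]
    by eventually_elim (simp add: k_def a1_def a_def A_def y0_def y1_def)
  then obtain b0 where b0: "b0 > 0" and
    y: "\<And>u. 0 \<le> u \<Longrightarrow> u < b0 \<Longrightarrow> y0 differentiable (at u) \<and> y1 differentiable (at u) \<and>
     k * y1 u = A u * y0 u + u * (1 - u) * p_f u * deriv y0 u \<and>
     a1 * p_f u ^ 2 * y0 u = a1 * (1 - 5 * u) * y1 u + u * (1 - u) * deriv y1 u"
    by (rule eventually_nhds_imp_Ico) (metis less_eq_real_def)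
  define b where "b = min b0 1"
  have b: "b > 0" "b \<le> 1" "b \<le> b0" using b0 by (auto simp: b_def)
  have Dy0: "(y0 has_real_derivative deriv y0 u) (at u)" and Dy1: "(y1 has_real_derivative deriv y1 u) (at u)"
    if "0 \<le> u" "u < b" for u
    using y[of u] that b by (auto simp: DERIV_deriv_iff_real_differentiable)
  define w where "w u = y0 u * h1 u - y1 u * h0 u" for u
  define w' where "w' u = deriv y0 u * h1 u + y0 u * d1 u - (deriv y1 u * h0 u + y1 u * d0 u)" for u
  have Dw: "(w has_real_derivative w' u) (at u)" if "0 \<le> u" "u < b" for u
    unfolding w_def w'_def using that b
    by (auto intro!: derivative_eq_intros Dy0 Dy1 h0 h1)
  have up': "k * h1 u = A u * h0 u + u * (1 - u) * p_f u * d0 u" if "0 \<le> u" "u < b" for u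
    using up[of u] that b by (simp add: A_def k_def a_def)
  have kw: "k * w u = u * (1 - u) * p_f u * (y0 u * d0 u - deriv y0 u * h0 u)" if "0 \<le> u" "u < b" for u
  proof -
    have "k * y1 u = A u * y0 u + u * (1 - u) * p_f u * deriv y0 u"
      using y[of u] that b by simp
    thus ?thesis using up'[OF that] unfolding w_def by algebra
  qed
  have "u * (1 - u) * p_f u * w' u = - (A u + a1 * p_f u * (1 - 5 * u)) * w u" if "0 \<le> u" "u < b" for u
  proof -
    have e: "k * y1 u = A u * y0 u + u * (1 - u) * p_f u * deriv y0 u"
            "a1 * p_f u ^ 2 * y0 u = a1 * (1 - 5 * u) * y1 u + u * (1 - u) * deriv y1 u"
            "a1 * p_f u ^ 2 * h0 u = a1 * (1 - 5 * u) * h1 u + u * (1 - u) * d1 u"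
      using y[of u] dn[of u] that b by (auto simp: a1_def)
    have "u * (1 - u) * p_f u * w' u =
        (u * (1 - u) * p_f u * deriv y0 u) * h1 u + p_f u * y0 u * (u * (1 - u) * d1 u) -
        (p_f u * h0 u * (u * (1 - u) * deriv y1 u) + y1 u * (u * (1 - u) * p_f u * d0 u))"
      unfolding w'_def by (simp add: algebra_simps)
    also have "u * (1 - u) * p_f u * deriv y0 u = k * y1 u - A u * y0 u"
      using e(1) by linarith
    also have "u * (1 - u) * p_f u * d0 u = k * h1 u - A u * h0 u"
      using up'[OF that] by linarith
    also have "u * (1 - u) * deriv y1 u = a1 * p_f u ^ 2 * y0 u - a1 * (1 - 5 * u) * y1 u"
      using e(2) by linarith
    also have "u * (1 - u) * d1 u = a1 * p_f u ^ 2 * h0 u - a1 * (1 - 5 * u) * h1 u"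
      using e(3) by linarith
    finally show ?thesis unfolding w_def by (simp add: algebra_simps)
  qed
  \<comment> \<open>The logarithmic derivative of \<open>w\<close> is therefore
    \<open>c / u - 4 * c / (1 - u)\<close> plus that of \<open>p_f\<close>, so \<open>w\<close> is a
    multiple of \<open>u powr c * (1 - u) powr (4 * c) * p_f u\<close>; the quotient is
    \<open>W\<close>.\<close>
  moreover have "- (A u + a1 * p_f u * (1 - 5 * u)) =
      c * (1 - u) * p_f u - 4 * c * u * p_f u + u * (1 - u) * (14 + 2 * u)" for u
    unfolding A_def p_e_def p_f_def kc
    by (simp add: field_simps power2_eq_square power3_eq_cube)
  ultimately have w': "u * (1 - u) * p_f u * w' u =
      (c * (1 - u) * p_f u - 4 * c * u * p_f u + u * (1 - u) * (14 + 2 * u)) * w u" if "0 \<le> u" "u < b" for u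
    using that by simp
  have frac: "x' * (E / p) + ((E * (- c / u + 4 * c / v)) * p - E * q) / (p * p) * x =
      E / (p * (u * v * p)) * (u * v * p * x' - (c * v * p - 4 * c * u * p + u * v * q) * x)"
    if "u \<noteq> 0" "v \<noteq> 0" "p \<noteq> 0" for x' x E p q u v :: real
    using that by (simp add: field_simps)
  define W where "W u = w u * (u powr (- c) * (1 - u) powr (- (4 * c)) / p_f u)" for u
  have w0: "w 0 = 0" using kw[of 0] b k by simp
  have "w u = 0" if u: "0 < u" "u < b" for u
  proof -
    have "W u = 0"
    proof (rule zero_derivative_imp_eq_limit[of 0 b W])
      fix u assume u: "0 < u" "u < b"
      have u1: "u < 1" "p_f u > 0" using u b p_f_nonzero_pos[of u] by auto
      have "((\<lambda>u. u powr (- c) * (1 - u) powr (- (4 * c))) has_real_derivative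
           u powr (- c) * (1 - u) powr (- (4 * c)) * (- c / u + 4 * c / (1 - u))) (at u)"
      proof (rule DERIV_cong)
        show "((\<lambda>u. u powr (- c) * (1 - u) powr (- (4 * c))) has_real_derivative
            (- c * u powr (- c - 1)) * (1 - u) powr (- (4 * c)) +
            (- (4 * c) * (1 - u) powr (- (4 * c) - 1) * (0 - 1)) * u powr (- c)) (at u)"
          using u u1
          by (intro DERIV_mult has_real_derivative_powr
              DERIV_chain2[where f = "\<lambda>u. u powr (- (4 * c))"] DERIV_diff DERIV_const DERIV_ident) auto
        have "u powr (- c - 1) = u powr (- c) / u"
             "(1 - u) powr (- (4 * c) - 1) = (1 - u) powr (- (4 * c)) / (1 - u)"
          using u u1 by (simp_all add: powr_diff)
        thus "(- c * u powr (- c - 1)) * (1 - u) powr (- (4 * c)) +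
            (- (4 * c) * (1 - u) powr (- (4 * c) - 1) * (0 - 1)) * u powr (- c) =
            u powr (- c) * (1 - u) powr (- (4 * c)) * (- c / u + 4 * c / (1 - u))"
          by (simp add: algebra_simps)
      qed
      moreover define E where "E = u powr (- c) * (1 - u) powr (- (4 * c))"
      ultimately have DE: "((\<lambda>u. u powr (- c) * (1 - u) powr (- (4 * c)) / p_f u) has_real_derivative
         ((E * (- c / u + 4 * c / (1 - u))) * p_f u - E * (14 + 2 * u)) / (p_f u * p_f u)) (at u)"
        using DERIV_divide[OF _ DERIV_p_f[of u]] u1 by simp
      have "(W has_real_derivative
         (w' u * (E / p_f u) + ((E * (- c / u + 4 * c / (1 - u))) * p_f u - E * (14 + 2 * u)) / (p_f u * p_f u) * w u)) (at u)"
        unfolding W_def E_def by (rule DERIV_mult[OF Dw DE[unfolded E_def]]) (use u in auto)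
      also have "w' u * (E / p_f u) + ((E * (- c / u + 4 * c / (1 - u))) * p_f u - E * (14 + 2 * u)) / (p_f u * p_f u) * w u
        = E / (p_f u * (u * (1 - u) * p_f u)) * (u * (1 - u) * p_f u * w' u -
        (c * (1 - u) * p_f u - 4 * c * u * p_f u + u * (1 - u) * (14 + 2 * u)) * w u)"
        using u u1 by (intro frac) auto
      also have "\<dots> = 0" using w'[of u] u by simp
      finally show "(W has_real_derivative 0) (at u)" .
    next
      \<comment> \<open>Since \<open>w 0 = 0\<close>, the quotient \<open>w u / u\<close> stays
        bounded. The remaining power \<open>u powr (1 - c)\<close> tends to 0 because
        \<open>m <= 0\<close> makes \<open>c\<close> at most 1/4.\<close>
      have "((\<lambda>u. (w u - w 0) / (u - 0)) \<longlongrightarrow> w' 0) (at 0)"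
        using Dw[of 0] b unfolding has_field_derivative_iff by simp
      hence 1: "((\<lambda>u. w u / u) \<longlongrightarrow> w' 0) (at_right 0)"
        by (auto simp: w0 intro: filterlim_mono[OF _ order_refl at_le])
      have 2: "((\<lambda>u. u powr (1 - c)) \<longlongrightarrow> 0 powr (1 - c)) (at_right 0)"
        using m by (intro tendsto_powr' tendsto_const tendsto_ident_at)
           (auto simp: c_def eventually_at_filter)
      have 3: "((\<lambda>u. (1 - u) powr (- (4 * c)) / p_f u) \<longlongrightarrow> (1 - 0) powr (- (4 * c)) / p_f 0) (at_right 0)"
        unfolding p_f_def by (intro tendsto_intros) auto
      have "((\<lambda>u. w u / u * u powr (1 - c) * ((1 - u) powr (- (4 * c)) / p_f u)) \<longlongrightarrow> 0) (at_right 0)"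
        using tendsto_mult[OF tendsto_mult[OF 1 2] 3] by simp
      moreover have "\<forall>\<^sub>F u in at_right 0. w u / u * u powr (1 - c) * ((1 - u) powr (- (4 * c)) / p_f u) = W u"
        using eventually_at_right_less[of "0::real"]
      proof eventually_elim
        case (elim u)
        have "u powr (1 - c) = u * u powr (- c)"
          using elim powr_add[of u 1 "- c"] by simp
        thus ?case using elim by (simp add: W_def)
      qed
      ultimately show "(W \<longlongrightarrow> 0) (at_right 0)"
        by (rule Lim_transform_eventually)
    qed (use u in auto)
    thus ?thesis using u b p_f_nonzero_pos[of u] by (auto simp: W_def)
  qed
  note w = this
  \<comment> \<open>By \<open>kw\<close>, a vanishing cross term means that the Wronskian of
    \<open>y0\<close> and \<open>h0\<close> vanishes, so their quotient is constant; at 0 both equal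
    1.\<close>
  have "y0 u / h0 u = 1" if u: "0 < u" "u < b" for u
  proof (rule zero_derivative_imp_eq_limit[of 0 b "\<lambda>u. y0 u / h0 u"])
    fix u assume u: "0 < u" "u < b"
    have "y0 u * d0 u - deriv y0 u * h0 u = 0"
      using kw[of u] w[OF u] u b p_f_nonzero_pos[of u] by auto
    hence z: "(deriv y0 u * h0 u - y0 u * d0 u) / (h0 u * h0 u) = 0" by simp
    have "((\<lambda>u. y0 u / h0 u) has_real_derivative
       (deriv y0 u * h0 u - y0 u * d0 u) / (h0 u * h0 u)) (at u)"
      using u b h0_nz[of u] by (intro DERIV_divide Dy0 h0) auto
    thus "((\<lambda>u. y0 u / h0 u) has_real_derivative 0) (at u)" unfolding z .
  next
    have "isCont (\<lambda>u. y0 u / h0 u) 0"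
      using Dy0[of 0] h0[of 0] b h00 by (intro continuous_intros DERIV_isCont) auto
    moreover have "y0 0 / h0 0 = 1"
      using h00 octahedral_function_at_0[OF oct] by (simp add: y0_def)
    ultimately show "((\<lambda>u. y0 u / h0 u) \<longlongrightarrow> 1) (at_right 0)"
      unfolding isCont_def by (metis filterlim_mono order_refl at_le subset_UNIV)
  qed (use u in auto)
  hence "y0 u = h0 u" if "0 < u" "u < b" for u
    using that h0_nz[of u] b by (auto simp: field_simps)
  thus ?thesis
    using b(1) unfolding eventually_at_right_field y0_def by auto
qed

lemma octahedral_base_0:
  assumes oct: "\<And>n m. octahedral_function n m (r n m)"
  shows "r 0 0 u = 1"
proof -
  have "\<forall>\<^sub>F u in at_right 0. r 0 0 u = 1"
  \<comment> \<open>The companion \<open>?h1.0\<close> is forced by the raising relation with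
    \<open>h0 = 1\<close>; what has to be checked is that the lowering relation leads back to
    1.\<close>
  proof (rule octahedral_base[OF oct, where ?h1.0 = "\<lambda>u. p_e u - 6 / 7 * (7 * u - 6 * u ^ 2 - u ^ 3)"
        and ?d0.0 = "\<lambda>_. 0" and ?d1.0 = "\<lambda>u. - 33 - 66 * u + 3 * u ^ 2 - 6 / 7 * (7 - 12 * u - 3 * u ^ 2)"])
    fix u :: real
    show "((\<lambda>u. p_e u - 6 / 7 * (7 * u - 6 * u ^ 2 - u ^ 3)) has_real_derivative
       - 33 - 66 * u + 3 * u ^ 2 - 6 / 7 * (7 - 12 * u - 3 * u ^ 2)) (at u)"
      by (auto intro!: derivative_eq_intros DERIV_p_e)
  qed (auto simp: oct_k_def oct_a_def p_e_def p_f_def field_simps power2_eq_square power3_eq_cube)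
  hence "\<forall>\<^sub>F u in at_right 0. r 0 0 u * poly 1 u = poly 1 u" by simp
  moreover have "rational_fun (r 0 0)" using oct octahedral_function_alt by blast
  ultimately have "r 0 0 u = poly 1 u / poly 1 u" by (intro rational_fun_eqI) auto
  thus ?thesis by simp
qed

lemma octahedral_base_m1:
  assumes oct: "\<And>n m. octahedral_function n m (r n m)" and u: "u \<noteq> 1"
  shows "r 0 (-1) u = (1 + u / 7) / (1 - u) ^ 3"
proof -
  \<comment> \<open>\<open>N u / (1 - u) ^ 3\<close> is the companion that the raising relation
    forces on \<open>(1 + u / 7) / (1 - u) ^ 3\<close>. \<open>id1\<close> and \<open>id2\<close>
    are the raising and lowering relations cleared of denominators.\<close>
  define N where "N u = 1 - 32 / 7 * u + 6 / 7 * u ^ 2 - 8 / 7 * u ^ 3 + u ^ 4 / 133" for u :: real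
  define N' where "N' u = - 32 / 7 + 12 / 7 * u - 24 / 7 * u ^ 2 + 4 * u ^ 3 / 133" for u :: real
  have DN: "(N has_real_derivative N' u) (at u)" for u
    unfolding N_def N'_def by (auto intro!: derivative_eq_intros)
  have id1: "19 / 24 * N u = (19 / 24 * p_e u + 11 / 4 * u * (1 - u) * (u + 7)) * (1 + u / 7)
      + u * (1 - u) * p_f u * (1 / 7) + u * p_f u * (3 * (1 + u / 7))" for u
    unfolding N_def p_e_def p_f_def
    by (simp add: field_simps power2_eq_square power3_eq_cube power4_eq_xxxx)
  have id2: "- 1 / 24 * p_f u ^ 2 * (1 + u / 7) =
      - 1 / 24 * (1 - 5 * u) * N u + u * (1 - u) * N' u + u * (3 * N u)" for u
    unfolding N_def N'_def p_f_def
    by (simp add: field_simps power2_eq_square power3_eq_cube power4_eq_xxxx)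
  have frac: "x * (N / v ^ 3) + u * v * y * (N' / v ^ 3 + 3 * N / v ^ 4) =
      (x * N + u * v * y * N' + u * y * (3 * N)) / v ^ 3" if "v \<noteq> 0" for x y u v N N' :: real
  proof -
    have "u * v * y * (3 * N / v ^ 4) = u * y * (3 * N) / v ^ 3"
      using that by (simp add: power4_eq_xxxx power3_eq_cube)
    thus ?thesis by (simp add: add_divide_distrib distrib_left)
  qed
  have Dfrac: "((\<lambda>u. f u / (1 - u) ^ 3) has_real_derivative f' / (1 - u) ^ 3 + 3 * f u / (1 - u) ^ 4) (at u)"
    if "(f has_real_derivative f') (at u)" "u \<noteq> 1" for f f' and u :: real
  proof -
    define v where "v = 1 - u"
    have v: "v \<noteq> 0" using that by (simp add: v_def)
    have "(f' * v ^ 3 - f u * (- 3 * v ^ 2)) / (v ^ 3 * v ^ 3) = f' / v ^ 3 + 3 * f u / v ^ 4"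
      using v by (simp add: field_simps power2_eq_square power3_eq_cube power4_eq_xxxx)
    moreover have "((\<lambda>u. f u / (1 - u) ^ 3) has_real_derivative
        (f' * v ^ 3 - f u * (- 3 * v ^ 2)) / (v ^ 3 * v ^ 3)) (at u)"
      using that unfolding v_def by (auto intro!: derivative_eq_intros)
    ultimately show ?thesis by (simp add: v_def)
  qed
  have k: "oct_k (-1) 0 = 19 / 24" "oct_a (-1) 0 = 11 / 24" "oct_a (-1) 1 = - 1 / 24"
    by (simp_all add: oct_k_def oct_a_def)
  have "\<forall>\<^sub>F u in at_right 0. r 0 (-1) u = (1 + u / 7) / (1 - u) ^ 3"
  proof (rule octahedral_base[OF oct, where ?h1.0 = "\<lambda>u. N u / (1 - u) ^ 3"
        and ?d0.0 = "\<lambda>u. (1 / 7) / (1 - u) ^ 3 + 3 * (1 + u / 7) / (1 - u) ^ 4"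
        and ?d1.0 = "\<lambda>u. N' u / (1 - u) ^ 3 + 3 * N u / (1 - u) ^ 4"])
    fix u :: real assume u: "0 \<le> u" "u < 1"
    show "((\<lambda>u. (1 + u / 7) / (1 - u) ^ 3) has_real_derivative
        (1 / 7) / (1 - u) ^ 3 + 3 * (1 + u / 7) / (1 - u) ^ 4) (at u)"
      using u by (intro Dfrac[where f = "\<lambda>u. 1 + u / 7"]) (auto intro!: derivative_eq_intros)
    show "((\<lambda>u. N u / (1 - u) ^ 3) has_real_derivative
        N' u / (1 - u) ^ 3 + 3 * N u / (1 - u) ^ 4) (at u)"
      using u by (intro Dfrac DN) auto
    show "oct_k (-1) 0 * (N u / (1 - u) ^ 3) =
         (oct_k (-1) 0 * p_e u + 6 * oct_a (-1) 0 * u * (1 - u) * (u + 7)) * ((1 + u / 7) / (1 - u) ^ 3) +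
         u * (1 - u) * p_f u * ((1 / 7) / (1 - u) ^ 3 + 3 * (1 + u / 7) / (1 - u) ^ 4)"
    proof -
      have "19 / 24 * (N u / (1 - u) ^ 3) = (19 / 24 * N u) / (1 - u) ^ 3" by simp
      also have "\<dots> = ((19 / 24 * p_e u + 6 * (11 / 24) * u * (1 - u) * (u + 7)) * (1 + u / 7)
          + u * (1 - u) * p_f u * (1 / 7) + u * p_f u * (3 * (1 + u / 7))) / (1 - u) ^ 3"
        unfolding id1 by simp
      finally show ?thesis
        unfolding k using u by (subst frac) simp_all
    qed
    show "oct_a (-1) 1 * p_f u ^ 2 * ((1 + u / 7) / (1 - u) ^ 3) =
         oct_a (-1) 1 * (1 - 5 * u) * (N u / (1 - u) ^ 3) +
         u * (1 - u) * (N' u / (1 - u) ^ 3 + 3 * N u / (1 - u) ^ 4)"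
    proof -
      have "- 1 / 24 * p_f u ^ 2 * ((1 + u / 7) / (1 - u) ^ 3) =
          (- 1 / 24 * p_f u ^ 2 * (1 + u / 7)) / (1 - u) ^ 3" by simp
      also have "\<dots> = (- 1 / 24 * (1 - 5 * u) * N u + u * (1 - u) * 1 * N' u + u * 1 * (3 * N u)) / (1 - u) ^ 3"
        unfolding id2 by simp
      also have "\<dots> = - 1 / 24 * (1 - 5 * u) * (N u / (1 - u) ^ 3) +
         u * (1 - u) * 1 * (N' u / (1 - u) ^ 3 + 3 * N u / (1 - u) ^ 4)"
        using u by (subst frac) simp_all
      finally show ?thesis unfolding k by simp
    qed
  qed (auto simp: add_nonneg_eq_0_iff)
  hence "\<forall>\<^sub>F u in at_right 0. r 0 (-1) u * poly ([:1, -1:] ^ 3) u = poly [:1, 1 / 7:] u"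
    using eventually_at_right_real[of 0 "1 :: real", simplified]
    by eventually_elim (auto simp: poly_power)
  moreover have "rational_fun (r 0 (-1))" using oct octahedral_function_alt by blast
  ultimately have "r 0 (-1) u = poly [:1, 1 / 7:] u / poly ([:1, -1:] ^ 3) u"
    using u by (intro rational_fun_eqI) (auto simp: poly_power)
  thus ?thesis by (simp add: poly_power)
qed

subsection \<open>The first-order system in the variable s\<close>

text \<open>The degree bound says that \<open>r n m\<close> is at most of order
  \<open>3 * n + 2 * m\<close> in \<open>u\<close> at infinity. It survives the recursion: a step up
  adds 3 to the degree, and a step down also adds 3 but puts \<open>p_f\<close> cubed, of degree 6,
  into the denominator.\<close>

lemma octahedral_form:
  assumes oct: "\<And>n m. octahedral_function n m (r n m)" and m: "m = 0 \<or> m = -1"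
  shows "\<exists>p k. int (degree p) \<le> 3 * n - m + 2 * int k \<and>
    (\<forall>u. p_f u \<noteq> 0 \<longrightarrow> u \<noteq> 1 \<longrightarrow> r n m u = poly p u / (p_f u ^ k * (1 - u) ^ nat (- 3 * m)))"
proof (induction n rule: int_induct[where k = 0])
  case base
  from m show ?case
  proof
    assume "m = 0"
    thus ?thesis using octahedral_base_0[of r, OF oct]
      by (intro exI[of _ 1] exI[of _ 0]) simp
  next
    assume "m = -1"
    thus ?thesis using octahedral_base_m1[of r, OF oct]
      by (intro exI[of _ "[:1, 1 / 7:]"] exI[of _ 0]) simp
  qed
next
  case (step1 i)
  then obtain p k where p: "int (degree p) \<le> 3 * i - m + 2 * int k"
    "\<And>u. p_f u \<noteq> 0 \<Longrightarrow> u \<noteq> 1 \<Longrightarrow> r i m u = poly p u / (p_f u ^ k * (1 - u) ^ nat (- 3 * m))"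
    by auto
  from octahedral_step[of r i m, OF oct p(2)] obtain pu where
    "degree pu \<le> degree p + 3"
    "\<And>u. p_f u \<noteq> 0 \<Longrightarrow> u \<noteq> 1 \<Longrightarrow> r (i + 1) m u = poly pu u / (p_f u ^ k * (1 - u) ^ nat (- 3 * m))"
    by metis
  thus ?case using p(1) by (intro exI[of _ pu] exI[of _ k]) auto
next
  case (step2 i)
  then obtain p k where p: "int (degree p) \<le> 3 * i - m + 2 * int k"
    "\<And>u. p_f u \<noteq> 0 \<Longrightarrow> u \<noteq> 1 \<Longrightarrow> r i m u = poly p u / (p_f u ^ k * (1 - u) ^ nat (- 3 * m))"
    by auto
  from octahedral_step[of r i m, OF oct p(2)] obtain pd where
    "degree pd \<le> degree p + 3"
    "\<And>u. p_f u \<noteq> 0 \<Longrightarrow> u \<noteq> 1 \<Longrightarrow> r (i - 1) m u = poly pd u / (p_f u ^ (k + 3) * (1 - u) ^ nat (- 3 * m))"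
    by metis
  thus ?case using p(1) by (intro exI[of _ pd] exI[of _ "k + 3"]) auto
qed

lemma octahedral_contiguous:
  assumes oct: "\<And>n m. octahedral_function n m (r n m)" and m: "m = 0 \<or> m = -1"
      and u: "p_f u \<noteq> 0" "u \<noteq> 1"
  obtains d where "(r n m has_real_derivative d) (at u)"
    "oct_k m n * r (n + 1) m u =
       (oct_k m n * p_e u + 6 * oct_a m n * u * (1 - u) * (u + 7)) * r n m u + u * (1 - u) * p_f u * d"
    "oct_a m n * p_f u ^ 2 * r (n - 1) m u = oct_a m n * (1 - 5 * u) * r n m u + u * (1 - u) * d"
proof -
  obtain p k where
    "\<And>u. p_f u \<noteq> 0 \<Longrightarrow> u \<noteq> 1 \<Longrightarrow> r n m u = poly p u / (p_f u ^ k * (1 - u) ^ nat (- 3 * m))"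
    using octahedral_form[of r m n, OF oct m] by auto
  from octahedral_step[of r n m, OF oct this] u that show thesis by metis
qed

lemma q_f_alt: "q_f s = p_f (s ^ 4)"
  by (simp add: q_f_def p_f_def flip: power_mult)

lemma q_f_pos: "q_f s > 0"
  unfolding q_f_alt by (rule p_f_nonzero_pos) simp

lemma q_v_pos: "0 < s \<Longrightarrow> s < 1 \<Longrightarrow> q_v s > 0"
  by (simp add: q_v_def power_less_one_iff)

lemma power4_eq_1_iff: "s > 0 \<Longrightarrow> s ^ 4 = 1 \<longleftrightarrow> s = 1" for s :: real
  using power_eq_iff_eq_base[of 4 s 1] by simp

lemma q_v_nonzero: "s > 0 \<Longrightarrow> s \<noteq> 1 \<Longrightarrow> q_v s \<noteq> 0"
  using power4_eq_1_iff[of s] by (simp add: q_v_def)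

lemma DERIV_q_v: "(q_v has_real_derivative (1 - 5 * s ^ 4)) (at s)"
  unfolding q_v_def by (auto intro!: derivative_eq_intros simp: algebra_simps power_numeral_reduce)

lemma DERIV_q_f: "(q_f has_real_derivative (8 * s ^ 3 * (7 + s ^ 4))) (at s)"
  unfolding q_f_def by (auto intro!: derivative_eq_intros simp: algebra_simps power_numeral_reduce)

definition q_vf' :: "real \<Rightarrow> real" where
  "q_vf' s = 1 + 65 * s ^ 4 - 117 * s ^ 8 - 13 * s ^ 12"

text \<open>In terms of binary forms, the first-order operator in the relations below is a transvectant with
  \<open>q_v q_f\<close>, which is why the relations are preserved by the rotations of the octahedron;
  \<open>q_vf'\<close> is the derivative of \<open>q_v q_f\<close>.\<close>

definition octsys :: "int \<Rightarrow> (int \<Rightarrow> real \<Rightarrow> real) \<Rightarrow> real \<Rightarrow> bool" where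
  "octsys m X s \<longleftrightarrow> (\<forall>n. \<exists>d. (X n has_real_derivative d) (at s) \<and>
     oct_k m n * q_f s powr (3 / 2) * X (n + 1) s =
       q_v s * q_f s / 4 * d + ((of_int n / 2 + 13 / 42) * p_e (s ^ 4) - q_vf' s / 56) * X n s \<and>
     oct_a m n * q_f s powr (3 / 2) * X (n - 1) s =
       q_v s * q_f s / 4 * d - ((of_int n / 2 + 1 / 42) * p_e (s ^ 4) + q_vf' s / 56) * X n s)"

definition oct_A :: "(int \<Rightarrow> int \<Rightarrow> real \<Rightarrow> real) \<Rightarrow> int \<Rightarrow> int \<Rightarrow> real \<Rightarrow> real" where
  "oct_A r m n s = q_v s powi (- 2 * m) * q_f s powr (- 3 * of_int n / 2) * r n m (s ^ 4)"

text \<open>The logarithmic derivative of the prefactor is what turns the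
  \<open>u\<close>-coefficients of the contiguous relations into combinations of \<open>p_e\<close>
  and the derivative of \<open>q_v q_f\<close>. \<open>id1\<close> and \<open>id2\<close> are the
  two polynomial identities behind this.\<close>

lemma octsys_oct_A:
  assumes oct: "\<And>n m. octahedral_function n m (r n m)" and m: "m = 0 \<or> m = -1"
      and s: "s > 0" "s \<noteq> 1"
  shows "octsys m (oct_A r m) s"
  unfolding octsys_def
proof
  fix n
  define u where "u = s ^ 4"
  have u: "p_f u \<noteq> 0" "u \<noteq> 1"
    using s q_f_pos[of s] by (auto simp: u_def q_f_alt power4_eq_1_iff)
  obtain d where d: "(r n m has_real_derivative d) (at u)"
    and up: "oct_k m n * r (n + 1) m u =
       (oct_k m n * p_e u + 6 * oct_a m n * u * (1 - u) * (u + 7)) * r n m u + u * (1 - u) * p_f u * d"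
    and dn: "oct_a m n * p_f u ^ 2 * r (n - 1) m u = oct_a m n * (1 - 5 * u) * r n m u + u * (1 - u) * d"
    using octahedral_contiguous[of r m u n, OF oct m u] by metis
  have qv: "q_v s \<noteq> 0" and qf: "q_f s > 0"
    using s q_v_nonzero q_f_pos by auto
  define E where "E = q_v s powi (- 2 * m) * q_f s powr (- 3 * of_int n / 2)"
  define D where "D = E * ((- 2 * of_int m * (1 - 5 * u) / q_v s
       - 3 * of_int n / 2 * (8 * s ^ 3 * (7 + u)) / q_f s) * r n m u + 4 * s ^ 3 * d)"
  have DA: "(oct_A r m n has_real_derivative D) (at s)"
  proof -
    have "((\<lambda>s. q_v s powi (- 2 * m)) has_real_derivative
        of_int (- 2 * m) * q_v s powi (- 2 * m - 1) * (1 - 5 * s ^ 4)) (at s)"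
      using qv by (auto intro!: derivative_eq_intros DERIV_q_v)
    hence 1: "((\<lambda>s. q_v s powi (- 2 * m)) has_real_derivative
        q_v s powi (- 2 * m) * (- 2 * of_int m * (1 - 5 * u) / q_v s)) (at s)"
      by (rule DERIV_cong) (use qv in \<open>simp add: u_def power_int_diff field_simps\<close>)
    have 0: "((\<lambda>s. q_f s powr (- 3 * of_int n / 2)) has_real_derivative
        (- 3 * of_int n / 2) * q_f s powr (- 3 * of_int n / 2 - 1) * (8 * s ^ 3 * (7 + s ^ 4))) (at s)"
      by (rule DERIV_chain2[OF has_real_derivative_powr DERIV_q_f]) (rule qf)
    have powr_pred: "q_f s powr (- 3 * of_int n / 2 - 1) = q_f s powr (- 3 * of_int n / 2) / q_f s"
      using qf powr_diff[of "q_f s" "- 3 * of_int n / 2" 1] by simp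
    have 2: "((\<lambda>s. q_f s powr (- 3 * of_int n / 2)) has_real_derivative
        q_f s powr (- 3 * of_int n / 2) * (- (3 * of_int n / 2 * (8 * s ^ 3 * (7 + u)) / q_f s))) (at s)"
      by (rule DERIV_cong[OF 0[unfolded powr_pred]]) (simp add: u_def)
    have 3: "((\<lambda>s. r n m (s ^ 4)) has_real_derivative d * (4 * s ^ 3)) (at s)"
    proof (rule DERIV_chain2[where f = "r n m" and g = "\<lambda>s. s ^ 4"])
      show "(r n m has_real_derivative d) (at (s ^ 4))" using d unfolding u_def .
      show "((\<lambda>s. s ^ 4) has_real_derivative 4 * s ^ 3) (at s)"
        by (auto intro!: derivative_eq_intros)
    qed
    show ?thesis
      unfolding oct_A_def
      by (rule DERIV_cong[OF DERIV_mult[OF DERIV_mult[OF 1 2] 3]])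
         (simp add: D_def E_def u_def algebra_simps)
  qed
  have V: "q_f s powr (3 / 2) * oct_A r m (n + 1) s = E * r (n + 1) m u"
       "q_f s powr (3 / 2) * oct_A r m (n - 1) s = E * q_f s ^ 3 * r (n - 1) m u"
  proof -
    have swap: "w * (q * p' * x) = q * p * x" if "w * p' = p" for w q p p' x :: real
      unfolding that[symmetric] by simp
    have "q_f s powr (3 / 2) * q_f s powr (- 3 * of_int (n + 1) / 2) = q_f s powr (- 3 * of_int n / 2)"
      unfolding powr_add[symmetric] by (rule arg_cong[where f = "\<lambda>x. _ powr x"]) (simp add: field_simps)
    from swap[OF this] show "q_f s powr (3 / 2) * oct_A r m (n + 1) s = E * r (n + 1) m u"
      unfolding oct_A_def E_def u_def .
    have "q_f s powr (3 / 2) * q_f s powr (- 3 * of_int (n - 1) / 2) =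
        q_f s powr (- 3 * of_int n / 2) * q_f s powr 3"
      unfolding powr_add[symmetric] by (rule arg_cong[where f = "\<lambda>x. _ powr x"]) (simp add: field_simps)
    also have "q_f s powr 3 = q_f s ^ 3"
      using qf by simp
    finally have "q_f s powr (3 / 2) * q_f s powr (- 3 * of_int (n - 1) / 2) =
        q_f s powr (- 3 * of_int n / 2) * q_f s ^ 3" .
    from swap[OF this] show "q_f s powr (3 / 2) * oct_A r m (n - 1) s = E * q_f s ^ 3 * r (n - 1) m u"
      unfolding oct_A_def E_def u_def by (simp only: mult.assoc)
  qed
  \<comment> \<open>Every \<open>s ^ 3\<close> comes from differentiating a function of
    \<open>s ^ 4\<close> and meets the factor \<open>q_v s\<close>; their product is a polynomial in
    \<open>u\<close>, so the verification takes place entirely in \<open>u\<close>.\<close>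
  have qvs: "q_v s * s ^ 3 = u * (1 - u)"
    by (simp add: q_v_def u_def algebra_simps power_numeral_reduce)
  have qfu: "q_f s = p_f u" by (simp add: q_f_alt u_def)
  have g: "q_vf' s = 1 + 65 * u - 117 * u ^ 2 - 13 * u ^ 3"
    by (simp add: q_vf'_def u_def flip: power_mult)
  have "q_v s * q_f s / 4 * D = E * ((- of_int m / 2 * (1 - 5 * u) * q_f s
       - 3 * of_int n * ((q_v s * s ^ 3) * (7 + u))) * r n m u + (q_v s * s ^ 3) * q_f s * d)"
    using qv qf by (simp add: D_def field_simps)
  hence D: "q_v s * q_f s / 4 * D = E * ((- of_int m / 2 * (1 - 5 * u) * p_f u
       - 3 * of_int n * (u * (1 - u) * (7 + u))) * r n m u + u * (1 - u) * p_f u * d)"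
    unfolding qvs qfu .
  have id1: "oct_k m n * p_e u + 6 * oct_a m n * u * (1 - u) * (u + 7) =
    (- of_int m / 2 * (1 - 5 * u) * p_f u - 3 * of_int n * (u * (1 - u) * (7 + u))) +
    ((of_int n / 2 + 13 / 42) * p_e u - q_vf' s / 56)"
    unfolding oct_k_def oct_a_def g p_e_def p_f_def
    by (simp add: field_simps power2_eq_square power3_eq_cube)
  have id2: "oct_a m n * (1 - 5 * u) * p_f u =
    (- of_int m / 2 * (1 - 5 * u) * p_f u - 3 * of_int n * (u * (1 - u) * (7 + u))) -
    ((of_int n / 2 + 1 / 42) * p_e u + q_vf' s / 56)"
    unfolding oct_a_def g p_e_def p_f_def
    by (simp add: field_simps power2_eq_square power3_eq_cube)
  have A: "oct_A r m n s = E * r n m u"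
    by (simp add: oct_A_def E_def u_def)
  show "\<exists>d. (oct_A r m n has_real_derivative d) (at s) \<and>
     oct_k m n * q_f s powr (3 / 2) * oct_A r m (n + 1) s =
       q_v s * q_f s / 4 * d + ((of_int n / 2 + 13 / 42) * p_e (s ^ 4) - q_vf' s / 56) * oct_A r m n s \<and>
     oct_a m n * q_f s powr (3 / 2) * oct_A r m (n - 1) s =
       q_v s * q_f s / 4 * d - ((of_int n / 2 + 1 / 42) * p_e (s ^ 4) + q_vf' s / 56) * oct_A r m n s"
  proof (intro exI conjI)
    show "(oct_A r m n has_real_derivative D) (at s)" by (rule DA)
    have "oct_k m n * q_f s powr (3 / 2) * oct_A r m (n + 1) s = E * (oct_k m n * r (n + 1) m u)"
      unfolding mult.assoc V by (simp add: mult_ac)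
    also have "\<dots> = q_v s * q_f s / 4 * D + ((of_int n / 2 + 13 / 42) * p_e u - q_vf' s / 56) * oct_A r m n s"
      unfolding up D A id1 by (simp add: algebra_simps)
    finally show "oct_k m n * q_f s powr (3 / 2) * oct_A r m (n + 1) s =
       q_v s * q_f s / 4 * D + ((of_int n / 2 + 13 / 42) * p_e (s ^ 4) - q_vf' s / 56) * oct_A r m n s"
      by (simp add: u_def)
    have "oct_a m n * q_f s powr (3 / 2) * oct_A r m (n - 1) s =
        E * (p_f u * (oct_a m n * p_f u ^ 2 * r (n - 1) m u))"
      unfolding qfu mult.assoc V[unfolded qfu] by (simp add: mult_ac power2_eq_square power3_eq_cube)
    also have "\<dots> = E * ((oct_a m n * (1 - 5 * u) * p_f u) * r n m u + u * (1 - u) * p_f u * d)"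
      unfolding dn by (simp add: algebra_simps)
    also have "\<dots> = q_v s * q_f s / 4 * D - ((of_int n / 2 + 1 / 42) * p_e u + q_vf' s / 56) * oct_A r m n s"
      unfolding D A id2 by (simp add: algebra_simps)
    finally show "oct_a m n * q_f s powr (3 / 2) * oct_A r m (n - 1) s =
       q_v s * q_f s / 4 * D - ((of_int n / 2 + 1 / 42) * p_e (s ^ 4) + q_vf' s / 56) * oct_A r m n s"
      by (simp add: u_def)
  qed
qed

text \<open>At \<open>s = 0\<close> the leading part is \<open>2 * m * (2 * m + 1) / s ^ 2\<close>,
  with indicial roots \<open>- 2 * m\<close> and \<open>1 + 2 * m\<close>. The dependence on
  \<open>n\<close> is confined to a multiple of \<open>q_v s ^ 2 / q_f s ^ 2\<close>, the weight of
  the integral.\<close>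

definition oct_pot :: "int \<Rightarrow> int \<Rightarrow> real \<Rightarrow> real" where
  "oct_pot m n s = ((4 * of_int m ^ 2 + 2 * of_int m) * q_f s ^ 3
     - 144 * of_int n * (3 * of_int n + 2) * q_v s ^ 4) / (q_v s * q_f s) ^ 2"

text \<open>Going up from \<open>n\<close> (\<open>U\<close>) and back down from
  \<open>n + 1\<close> (\<open>L\<close>) expresses the derivatives of \<open>X n\<close> and
  \<open>X (n + 1)\<close> through these two functions; eliminating \<open>X (n + 1)\<close> leaves
  a second-order equation for \<open>X n\<close>.\<close>

lemma octsys_second_derivative:
  assumes S: "open S" "s \<in> S" and sys: "\<And>s. s \<in> S \<Longrightarrow> octsys m X s"
      and qv: "\<And>s. s \<in> S \<Longrightarrow> q_v s \<noteq> 0"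
  shows "(deriv (X n) has_real_derivative oct_pot m n s * X n s) (at s)"
proof -
  define V where "V s = q_f s powr (3 / 2)" for s
  define c1 where "c1 s = (of_int n / 2 + 13 / 42) * p_e (s ^ 4) - q_vf' s / 56" for s
  define c3 where "c3 s = ((of_int n + 1) / 2 + 1 / 42) * p_e (s ^ 4) + q_vf' s / 56" for s
  define K a where "K = oct_k m n" and "a = oct_a m (n + 1)"
  define N where "N s = (4 * of_int m ^ 2 + 2 * of_int m) * q_f s ^ 3
     - 144 * of_int n * (3 * of_int n + 2) * q_v s ^ 4" for s
  define Z where "Z s = V s * X (n + 1) s" for s
  define G where "G s = q_v s * q_f s" for s
  have D: "(X n has_real_derivative deriv (X n) s) (at s)" if "s \<in> S" for n s
    using sys[OF that] unfolding octsys_def by (metis DERIV_imp_deriv)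
  have U: "K * Z s = G s / 4 * deriv (X n) s + c1 s * X n s" if "s \<in> S" for s
    using sys[OF that] unfolding octsys_def K_def V_def c1_def G_def Z_def
    by (metis DERIV_imp_deriv mult.assoc)
  have L: "a * V s * X n s = G s / 4 * deriv (X (n + 1)) s - c3 s * X (n + 1) s" if s: "s \<in> S" for s
  proof -
    obtain d where "(X (n + 1) has_real_derivative d) (at s)"
      "oct_a m (n + 1) * q_f s powr (3 / 2) * X (n + 1 - 1) s = q_v s * q_f s / 4 * d -
        ((of_int (n + 1) / 2 + 1 / 42) * p_e (s ^ 4) + q_vf' s / 56) * X (n + 1) s"
      using sys[OF s] unfolding octsys_def by blast
    thus ?thesis
      using DERIV_imp_deriv[of "X (n + 1)" d s] by (simp add: a_def V_def c3_def G_def)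
  qed
  define u where "u = s ^ 4"
  define w where "w = u * (1 - u)"
  have G0: "G s \<noteq> 0" if "s \<in> S" for s using qv[OF that] q_f_pos[of s] by (simp add: G_def)
  have qvs: "q_v s * s ^ 3 = w"
    by (simp add: w_def q_v_def u_def algebra_simps power_numeral_reduce)
  have qfu: "q_f s = p_f u" by (simp add: q_f_alt u_def)
  have g: "q_vf' s = 1 + 65 * u - 117 * u ^ 2 - 13 * u ^ 3"
    by (simp add: q_vf'_def u_def flip: power_mult)
  have DG: "(G has_real_derivative q_vf' s) (at s)"
  proof -
    have "(1 - 5 * u) * q_f s + 8 * s ^ 3 * (7 + u) * q_v s = (1 - 5 * u) * p_f u + 8 * (q_v s * s ^ 3) * (7 + u)"
      by (simp add: qfu)
    also have "\<dots> = q_vf' s"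
      unfolding qvs w_def g p_f_def by (simp add: algebra_simps power2_eq_square power3_eq_cube)
    finally show ?thesis
      unfolding G_def using DERIV_mult[OF DERIV_q_v[of s] DERIV_q_f[of s]] by (simp add: u_def)
  qed
  define d1 where "d1 = 4 * (of_int n / 2 + 13 / 42) * (- 33 - 66 * u + 3 * u ^ 2) - (260 - 936 * u - 156 * u ^ 2) / 56"
  have Dc1: "(c1 has_real_derivative s ^ 3 * d1) (at s)"
  proof -
    have "(q_vf' has_real_derivative 260 * s ^ 3 - 936 * s ^ 7 - 156 * s ^ 11) (at s)"
      unfolding q_vf'_def by (auto intro!: derivative_eq_intros)
    moreover have "((\<lambda>s. p_e (s ^ 4)) has_real_derivative (- 33 - 66 * u + 3 * u ^ 2) * (4 * s ^ 3)) (at s)"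
      unfolding u_def by (rule DERIV_chain2[OF DERIV_p_e]) (auto intro!: derivative_eq_intros)
    ultimately have "(c1 has_real_derivative (of_int n / 2 + 13 / 42) * ((- 33 - 66 * u + 3 * u ^ 2) * (4 * s ^ 3))
        - (260 * s ^ 3 - 936 * s ^ 7 - 156 * s ^ 11) / 56) (at s)"
      unfolding c1_def by (intro DERIV_diff DERIV_cmult DERIV_cdivide)
    thus ?thesis
      by (rule DERIV_cong) (simp add: d1_def u_def field_simps power_numeral_reduce)
  qed
  have DV: "(V has_real_derivative V s * (12 * s ^ 3 * (7 + u) / q_f s)) (at s)"
  proof -
    have 1: "(V has_real_derivative 3 / 2 * q_f s powr (3 / 2 - 1) * (8 * s ^ 3 * (7 + s ^ 4))) (at s)"
      unfolding V_def by (rule DERIV_chain2[OF has_real_derivative_powr DERIV_q_f]) (rule q_f_pos)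
    have 2: "q_f s powr (3 / 2 - 1) = V s / q_f s"
      using q_f_pos[of s] powr_diff[of "q_f s" "3 / 2" 1] by (simp add: V_def)
    from 1[unfolded 2] show ?thesis
      by (rule DERIV_cong) (simp add: u_def)
  qed
  \<comment> \<open>The half-integer power of \<open>q_f\<close> occurs once on the way up and once
    on the way down, so the resulting equation has rational coefficients.\<close>
  have V2: "V s * V s = q_f s ^ 3"
    using q_f_pos[of s] by (simp add: V_def flip: powr_add)
  let ?x = "X n s" and ?x' = "deriv (X n) s"
  let ?Z' = "V s * (12 * s ^ 3 * (7 + u) / q_f s) * X (n + 1) s + deriv (X (n + 1)) s * V s"
  have DZ: "(Z has_real_derivative ?Z') (at s)"
    unfolding Z_def by (rule DERIV_mult[OF DV D[OF S(2)]])
  have "((\<lambda>s. 4 * (K * Z s - c1 s * X n s) / G s) has_real_derivative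
      (4 * (K * ?Z' - (s ^ 3 * d1 * ?x + ?x' * c1 s)) * G s -
        4 * (K * Z s - c1 s * ?x) * q_vf' s) / (G s * G s)) (at s)"
    by (intro DERIV_divide DERIV_cmult DERIV_diff DZ DERIV_mult Dc1 D S DG G0)
  also have "4 * (K * ?Z' - (s ^ 3 * d1 * ?x + ?x' * c1 s)) * G s -
        4 * (K * Z s - c1 s * ?x) * q_vf' s = N s * ?x"
  proof -
    have "4 * G s * ?Z' = 16 * V s * (G s / 4 * deriv (X (n + 1)) s) + 48 * (q_v s * s ^ 3) * (7 + u) * Z s"
      using q_f_pos[of s] by (simp add: G_def Z_def field_simps)
    also have "G s / 4 * deriv (X (n + 1)) s = a * V s * ?x + c3 s * X (n + 1) s"
      using L[OF S(2)] by simp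
    finally have Z': "4 * G s * ?Z' = 16 * a * (V s * V s) * ?x + (16 * c3 s + 48 * w * (7 + u)) * Z s"
      by (simp add: qvs Z_def algebra_simps)
    have "4 * (K * ?Z' - (s ^ 3 * d1 * ?x + ?x' * c1 s)) * G s - 4 * (K * Z s - c1 s * ?x) * q_vf' s =
      K * (4 * G s * ?Z') - 4 * (G s * s ^ 3) * d1 * ?x - 4 * G s * c1 s * ?x' - 4 * (K * Z s - c1 s * ?x) * q_vf' s"
      by (simp add: algebra_simps)
    also have "\<dots> = 16 * K * a * q_f s ^ 3 * ?x + (16 * c3 s + 48 * w * (7 + u)) * (K * Z s)
       - 4 * (G s * s ^ 3) * d1 * ?x - 4 * G s * c1 s * ?x' - 4 * (K * Z s - c1 s * ?x) * q_vf' s"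
      unfolding Z' V2 by (simp add: algebra_simps)
    also have "\<dots> = (16 * K * a * q_f s ^ 3 + (16 * c3 s + 48 * w * (7 + u)) * c1 s - 4 * (G s * s ^ 3) * d1) * ?x
       + (4 * c3 s + 12 * w * (7 + u) - 4 * c1 s - q_vf' s) * (G s * ?x')"
      unfolding U[OF S(2)] by (simp add: field_simps)
    \<comment> \<open>This is the coefficient of the first derivative. Its vanishing is why the
      Wronskian can be used later without an integrating factor.\<close>
    also have "4 * c3 s + 12 * w * (7 + u) - 4 * c1 s - q_vf' s = 0"
      unfolding c3_def c1_def g u_def[symmetric] w_def p_e_def
      by (simp add: field_simps power2_eq_square power3_eq_cube)
    also have "G s * s ^ 3 = w * q_f s"
      by (simp add: G_def mult_ac flip: qvs)
    also have "16 * K * a * q_f s ^ 3 + (16 * c3 s + 48 * w * (7 + u)) * c1 s - 4 * (w * q_f s) * d1 = N s"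
    proof -
      have "q_v s ^ 4 = u * (1 - u) ^ 4"
        by (simp add: q_v_def u_def power_mult_distrib)
      note qv4 = this
      show ?thesis
        unfolding N_def qv4 qfu K_def a_def oct_k_def oct_a_def c3_def c1_def g u_def[symmetric] w_def
          p_e_def p_f_def d1_def
        by (simp add: field_simps power_numeral_reduce)
    qed
    finally show ?thesis by simp
  qed
  also have "N s * ?x / (G s * G s) = oct_pot m n s * ?x"
    by (simp add: oct_pot_def N_def G_def power2_eq_square)
  finally have "((\<lambda>s. 4 * (K * Z s - c1 s * X n s) / G s) has_real_derivative oct_pot m n s * ?x) (at s)" .
  moreover have ev: "\<forall>\<^sub>F s in nhds s. 4 * (K * Z s - c1 s * X n s) / G s = deriv (X n) s"
    using eventually_nhds_in_open[OF S]
  proof eventually_elim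
    case (elim s)
    thus ?case using U[OF elim] G0[OF elim] by simp
  qed
  ultimately show ?thesis
    using DERIV_cong_ev[OF refl ev refl] by blast
qed

subsection \<open>Rotations of the octahedron\<close>

text \<open>\<open>j\<close> is the automorphy factor. In the applications \<open>\<alpha>\<close>
  is a constant times \<open>j\<close> to the power -12 and \<open>\<phi>'\<close> a constant times
  \<open>j\<close> to the power -2, and hypothesis \<open>C\<close> is then the derivative of
  \<open>G\<close>: the term with 14 comes from differentiating \<open>j\<close> to the power -14.
  The derivative of \<open>j\<close> in the new solution absorbs this term, and
  \<open>\<epsilon>\<close> is compensated by the factor \<open>\<epsilon> powi n\<close>.\<close>

lemma octsys_moebius:
  assumes sys: "octsys m X (\<phi> s)"
      and \<phi>: "(\<phi> has_real_derivative \<phi>') (at s)" and j: "(j has_real_derivative j') (at s)"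
      and \<epsilon>: "\<epsilon> * \<epsilon> = (1 :: real)" and \<alpha>: "\<alpha> \<noteq> 0"
      and V: "q_f (\<phi> s) powr (3 / 2) = \<alpha> * q_f s powr (3 / 2)"
      and P: "p_e (\<phi> s ^ 4) = \<epsilon> * \<alpha> * p_e (s ^ 4)"
      and G: "q_v (\<phi> s) * q_f (\<phi> s) = \<epsilon> * \<alpha> * \<phi>' * (q_v s * q_f s)"
      and C: "\<alpha> * j s * q_vf' s = 14 * \<alpha> * (q_v s * q_f s) * j' + \<epsilon> * j s * q_vf' (\<phi> s)"
  shows "octsys m (\<lambda>n s. \<epsilon> powi n * (j s * X n (\<phi> s))) s"
  unfolding octsys_def
proof
  fix n
  obtain d where d: "(X n has_real_derivative d) (at (\<phi> s))"
   and up: "oct_k m n * q_f (\<phi> s) powr (3 / 2) * X (n + 1) (\<phi> s) =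
       q_v (\<phi> s) * q_f (\<phi> s) / 4 * d
         + ((of_int n / 2 + 13 / 42) * p_e (\<phi> s ^ 4) - q_vf' (\<phi> s) / 56) * X n (\<phi> s)"
   and dn: "oct_a m n * q_f (\<phi> s) powr (3 / 2) * X (n - 1) (\<phi> s) =
       q_v (\<phi> s) * q_f (\<phi> s) / 4 * d
         - ((of_int n / 2 + 1 / 42) * p_e (\<phi> s ^ 4) + q_vf' (\<phi> s) / 56) * X n (\<phi> s)"
    using sys unfolding octsys_def by blast
  define E where "E = \<epsilon> powi n"
  have \<epsilon>0: "\<epsilon> \<noteq> 0" using \<epsilon> by auto
  have E1: "\<epsilon> powi (n + 1) = E * \<epsilon>" using \<epsilon>0 by (simp add: E_def power_int_add)
  have "inverse \<epsilon> = \<epsilon>" using \<epsilon> by (metis inverse_unique)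
  hence E2: "\<epsilon> powi (n - 1) = E * \<epsilon>"
    using \<epsilon>0 by (simp add: E_def power_int_diff divide_inverse)
  define W g x where "W = q_f s powr (3 / 2)" and "g = q_v s * q_f s" and "x = X n (\<phi> s)"
  define D where "D = E * (j' * x + d * \<phi>' * j s)"
  have DY: "((\<lambda>s. \<epsilon> powi n * (j s * X n (\<phi> s))) has_real_derivative D) (at s)"
    unfolding D_def E_def x_def
    by (rule DERIV_cmult[OF DERIV_mult[OF j DERIV_chain2[OF d \<phi>]]])
  have 1: "oct_k m n * W * (\<epsilon> powi (n + 1) * (j s * X (n + 1) (\<phi> s))) =
       g / 4 * D + ((of_int n / 2 + 13 / 42) * p_e (s ^ 4) - q_vf' s / 56) * (\<epsilon> powi n * (j s * x))"
  proof -
    have "\<alpha> * (oct_k m n * W * (E * \<epsilon> * (j s * X (n + 1) (\<phi> s)))) =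
      E * \<epsilon> * j s * (oct_k m n * (\<alpha> * W) * X (n + 1) (\<phi> s))" by simp
    also have "\<dots> = E * \<epsilon> * j s * (\<epsilon> * \<alpha> * \<phi>' * g / 4 * d
         + ((of_int n / 2 + 13 / 42) * (\<epsilon> * \<alpha> * p_e (s ^ 4)) - q_vf' (\<phi> s) / 56) * x)"
      using up unfolding V P G W_def g_def x_def by simp
    also have "\<dots> = E * (\<epsilon> * \<epsilon>) * j s * (\<alpha> * \<phi>' * g / 4 * d
         + (of_int n / 2 + 13 / 42) * (\<alpha> * p_e (s ^ 4)) * x) - E * (\<epsilon> * j s * q_vf' (\<phi> s)) / 56 * x"
      by (simp add: algebra_simps)
    also have "\<epsilon> * j s * q_vf' (\<phi> s) = \<alpha> * j s * q_vf' s - 14 * \<alpha> * g * j'"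
      using C by (simp add: g_def)
    also have "E * (\<epsilon> * \<epsilon>) * j s * (\<alpha> * \<phi>' * g / 4 * d
         + (of_int n / 2 + 13 / 42) * (\<alpha> * p_e (s ^ 4)) * x) -
          E * (\<alpha> * j s * q_vf' s - 14 * \<alpha> * g * j') / 56 * x =
       \<alpha> * (g / 4 * D + ((of_int n / 2 + 13 / 42) * p_e (s ^ 4) - q_vf' s / 56) * (E * (j s * x)))"
      unfolding \<epsilon> D_def by (simp add: field_simps)
    finally show ?thesis using \<alpha> unfolding E1 E_def[symmetric] by (simp only: mult_cancel_left) simp
  qed
  have 2: "oct_a m n * W * (\<epsilon> powi (n - 1) * (j s * X (n - 1) (\<phi> s))) =
       g / 4 * D - ((of_int n / 2 + 1 / 42) * p_e (s ^ 4) + q_vf' s / 56) * (\<epsilon> powi n * (j s * x))"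
  proof -
    have "\<alpha> * (oct_a m n * W * (E * \<epsilon> * (j s * X (n - 1) (\<phi> s)))) =
      E * \<epsilon> * j s * (oct_a m n * (\<alpha> * W) * X (n - 1) (\<phi> s))" by simp
    also have "\<dots> = E * \<epsilon> * j s * (\<epsilon> * \<alpha> * \<phi>' * g / 4 * d
         - ((of_int n / 2 + 1 / 42) * (\<epsilon> * \<alpha> * p_e (s ^ 4)) + q_vf' (\<phi> s) / 56) * x)"
      using dn unfolding V P G W_def g_def x_def by simp
    also have "\<dots> = E * (\<epsilon> * \<epsilon>) * j s * (\<alpha> * \<phi>' * g / 4 * d
         - (of_int n / 2 + 1 / 42) * (\<alpha> * p_e (s ^ 4)) * x) - E * (\<epsilon> * j s * q_vf' (\<phi> s)) / 56 * x"
      by (simp add: algebra_simps)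
    also have "\<epsilon> * j s * q_vf' (\<phi> s) = \<alpha> * j s * q_vf' s - 14 * \<alpha> * g * j'"
      using C by (simp add: g_def)
    also have "E * (\<epsilon> * \<epsilon>) * j s * (\<alpha> * \<phi>' * g / 4 * d
         - (of_int n / 2 + 1 / 42) * (\<alpha> * p_e (s ^ 4)) * x) -
          E * (\<alpha> * j s * q_vf' s - 14 * \<alpha> * g * j') / 56 * x =
       \<alpha> * (g / 4 * D - ((of_int n / 2 + 1 / 42) * p_e (s ^ 4) + q_vf' s / 56) * (E * (j s * x)))"
      unfolding \<epsilon> D_def by (simp add: field_simps)
    finally show ?thesis using \<alpha> unfolding E2 E_def[symmetric] by (simp only: mult_cancel_left) simp
  qed
  show "\<exists>d. ((\<lambda>s. \<epsilon> powi n * (j s * X n (\<phi> s))) has_real_derivative d) (at s) \<and>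
     oct_k m n * q_f s powr (3 / 2) * (\<epsilon> powi (n + 1) * (j s * X (n + 1) (\<phi> s))) =
       q_v s * q_f s / 4 * d + ((of_int n / 2 + 13 / 42) * p_e (s ^ 4) - q_vf' s / 56) *
         (\<epsilon> powi n * (j s * X n (\<phi> s))) \<and>
     oct_a m n * q_f s powr (3 / 2) * (\<epsilon> powi (n - 1) * (j s * X (n - 1) (\<phi> s))) =
       q_v s * q_f s / 4 * d - ((of_int n / 2 + 1 / 42) * p_e (s ^ 4) + q_vf' s / 56) *
         (\<epsilon> powi n * (j s * X n (\<phi> s)))"
    using DY 1 2 unfolding W_def g_def x_def by blast
qed

lemma power8_powr: "x > 0 \<Longrightarrow> (x ^ 8) powr y = x powr (8 * y)" for x y :: real
  using powr_powr[of x 8 y] by simp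

lemma powr_three_halves_quotient:
  fixes x y c :: real
  assumes "x > 0" "y > 0" "c > 0"
  shows "(c ^ 2 * y / x ^ 8) powr (3 / 2) = c ^ 3 / x ^ 12 * y powr (3 / 2)"
proof -
  have "(c ^ 2) powr (3 / 2) = c ^ 3"
    using powr_powr[of c 2 "3 / 2"] assms by simp
  moreover have "(x ^ 8) powr (3 / 2) = x ^ 12"
    using power8_powr[of x "3 / 2"] assms by simp
  ultimately show ?thesis
    using assms by (simp add: powr_divide powr_mult)
qed

lemma q_inverse:
  assumes "s \<noteq> 0"
  shows "q_v (1 / s) = - q_v s / s ^ 6" "q_f (1 / s) = q_f s / s ^ 8"
    "p_e ((1 / s) ^ 4) = p_e (s ^ 4) / s ^ 12"
  using assms by (simp_all add: q_v_def q_f_def p_e_def field_simps power_numeral_reduce)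

lemma q_rotate:
  assumes "1 + s \<noteq> 0"
  shows "q_v ((1 - s) / (1 + s)) = 8 * q_v s / (1 + s) ^ 6"
    "q_f ((1 - s) / (1 + s)) = 16 * q_f s / (1 + s) ^ 8"
    "p_e (((1 - s) / (1 + s)) ^ 4) = - 64 * p_e (s ^ 4) / (1 + s) ^ 12"
    "q_vf' ((1 - s) / (1 + s)) =
       (14 * 64 * (q_v s * q_f s) - 64 * (1 + s) * q_vf' s) / (1 + s) ^ 13"
proof -
  define y where "y = 1 + s"
  have y: "y \<noteq> 0" and s: "s = y - 1" using assms by (auto simp: y_def)
  have t: "(1 - s) / (1 + s) = (2 - y) / y" "1 + s = y" by (auto simp: s)
  show "q_v ((1 - s) / (1 + s)) = 8 * q_v s / (1 + s) ^ 6"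
    unfolding t using y
    by (simp add: q_v_def s divide_simps) algebra
  show "q_f ((1 - s) / (1 + s)) = 16 * q_f s / (1 + s) ^ 8"
    unfolding t using y
    by (simp add: q_f_def s divide_simps) algebra
  show "p_e (((1 - s) / (1 + s)) ^ 4) = - 64 * p_e (s ^ 4) / (1 + s) ^ 12"
    unfolding t using y
    by (simp add: p_e_def s divide_simps) algebra
  show "q_vf' ((1 - s) / (1 + s)) =
       (14 * 64 * (q_v s * q_f s) - 64 * (1 + s) * q_vf' s) / (1 + s) ^ 13"
    unfolding t using y
    by (simp add: q_vf'_def q_v_def q_f_def s divide_simps) algebra
qed

lemma octsys_inverse:
  assumes "octsys m X (1 / s)" "s > 0"
  shows "octsys m (\<lambda>n s. s * X n (1 / s)) s"
proof -
  have "octsys m (\<lambda>n s. 1 powi n * (s * X n (1 / s))) s"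
  proof (rule octsys_moebius[where \<phi> = "\<lambda>s. 1 / s" and \<phi>' = "- 1 / s ^ 2" and j = "\<lambda>s. s"
        and j' = 1 and \<alpha> = "1 / s ^ 12"])
    show "((\<lambda>s. 1 / s) has_real_derivative - 1 / s ^ 2) (at s)"
      using assms by (auto intro!: derivative_eq_intros simp: power2_eq_square)
    show "q_f (1 / s) powr (3 / 2) = 1 / s ^ 12 * q_f s powr (3 / 2)"
      using powr_three_halves_quotient[of s "q_f s" 1] assms q_f_pos[of s] by (simp add: q_inverse)
    show "1 / s ^ 12 * s * q_vf' s = 14 * (1 / s ^ 12) * (q_v s * q_f s) * 1 + 1 * s * q_vf' (1 / s)"
      using assms by (simp add: q_vf'_def q_v_def q_f_def field_simps power_numeral_reduce)
    show "p_e ((1 / s) ^ 4) = 1 * (1 / s ^ 12) * p_e (s ^ 4)"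
      using assms by (subst q_inverse(3)) auto
    show "q_v (1 / s) * q_f (1 / s) = 1 * (1 / s ^ 12) * (- 1 / s ^ 2) * (q_v s * q_f s)"
      using assms by (simp add: q_inverse flip: power_add)
  qed (use assms in auto)
  thus ?thesis by simp
qed

text \<open>The half-turn fixes \<open>sqrt 2 - 1\<close>, a zero of the edge form
  \<open>p_e (s ^ 4)\<close>, and reverses the sign of that form; hence
  \<open>\<epsilon> = -1\<close>. The half-turn \<open>s -> 1 / s\<close> fixes the vertex 1 instead
  and has \<open>\<epsilon> = 1\<close>.\<close>

lemma octsys_rotate:
  assumes "octsys m X ((1 - s) / (1 + s))" "s > -1"
  shows "octsys m (\<lambda>n s. (-1) powi n * ((1 + s) * X n ((1 - s) / (1 + s)))) s"
proof (rule octsys_moebius[where \<phi> = "\<lambda>s. (1 - s) / (1 + s)" and \<phi>' = "- 2 / (1 + s) ^ 2"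
      and j = "\<lambda>s. 1 + s" and j' = 1 and \<alpha> = "64 / (1 + s) ^ 12"])
  have s: "1 + s > 0" using assms by simp
  show "((\<lambda>s. (1 - s) / (1 + s)) has_real_derivative - 2 / (1 + s) ^ 2) (at s)"
    using s by (auto intro!: derivative_eq_intros simp: power2_eq_square)
  show "q_f ((1 - s) / (1 + s)) powr (3 / 2) = 64 / (1 + s) ^ 12 * q_f s powr (3 / 2)"
    using powr_three_halves_quotient[of "1 + s" "q_f s" 4] s q_f_pos[of s] by (simp add: q_rotate)
  show "64 / (1 + s) ^ 12 * (1 + s) * q_vf' s =
      14 * (64 / (1 + s) ^ 12) * (q_v s * q_f s) * 1 + - 1 * (1 + s) * q_vf' ((1 - s) / (1 + s))"
  proof -
    have *: "64 / j ^ 12 * j * x = 14 * (64 / j ^ 12) * y * 1 + - 1 * j * ((14 * 64 * y - 64 * j * x) / j ^ 13)"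
      if "j \<noteq> 0" for j x y :: real
      using that by (simp add: field_simps power_numeral_reduce)
    have "1 + s \<noteq> 0" using s by simp
    thus ?thesis unfolding q_rotate(4)[OF \<open>1 + s \<noteq> 0\<close>] by (rule *)
  qed
  show "p_e (((1 - s) / (1 + s)) ^ 4) = - 1 * (64 / (1 + s) ^ 12) * p_e (s ^ 4)"
    using s by (simp add: q_rotate(3))
  show "q_v ((1 - s) / (1 + s)) * q_f ((1 - s) / (1 + s)) =
      - 1 * (64 / (1 + s) ^ 12) * (- 2 / (1 + s) ^ 2) * (q_v s * q_f s)"
    using s by (simp add: q_rotate flip: power_add)
  show "((\<lambda>s. 1 + s) has_real_derivative 1) (at s)"
    by (auto intro!: derivative_eq_intros)
qed (use assms in auto)

lemma octsys_add:
  assumes "octsys m X s" "octsys m Y s"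
  shows "octsys m (\<lambda>n s. c * (X n s + Y n s)) s"
  unfolding octsys_def
proof
  fix n
  obtain d where d: "(X n has_real_derivative d) (at s)"
     "oct_k m n * q_f s powr (3 / 2) * X (n + 1) s =
       q_v s * q_f s / 4 * d + ((of_int n / 2 + 13 / 42) * p_e (s ^ 4) - q_vf' s / 56) * X n s"
     "oct_a m n * q_f s powr (3 / 2) * X (n - 1) s =
       q_v s * q_f s / 4 * d - ((of_int n / 2 + 1 / 42) * p_e (s ^ 4) + q_vf' s / 56) * X n s"
    using assms(1) unfolding octsys_def by blast
  obtain e where e: "(Y n has_real_derivative e) (at s)"
     "oct_k m n * q_f s powr (3 / 2) * Y (n + 1) s =
       q_v s * q_f s / 4 * e + ((of_int n / 2 + 13 / 42) * p_e (s ^ 4) - q_vf' s / 56) * Y n s"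
     "oct_a m n * q_f s powr (3 / 2) * Y (n - 1) s =
       q_v s * q_f s / 4 * e - ((of_int n / 2 + 1 / 42) * p_e (s ^ 4) + q_vf' s / 56) * Y n s"
    using assms(2) unfolding octsys_def by blast
  have lin: "k * (c * (x + y)) = g * (c * (d + e)) + z * (c * (x0 + y0))"
    if "k * x = g * d + z * x0" "k * y = g * e + z * y0" for k x y g z x0 y0 :: real
  proof -
    have "k * (c * (x + y)) = c * (k * x + k * y)" by (simp add: algebra_simps)
    thus ?thesis unfolding that by (simp add: algebra_simps)
  qed
  have lin': "k * (c * (x + y)) = g * (c * (d + e)) - z * (c * (x0 + y0))"
    if "k * x = g * d - z * x0" "k * y = g * e - z * y0" for k x y g z x0 y0 :: real
  proof -
    have "k * (c * (x + y)) = c * (k * x + k * y)" by (simp add: algebra_simps)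
    thus ?thesis unfolding that by (simp add: algebra_simps)
  qed
  show "\<exists>d. ((\<lambda>s. c * (X n s + Y n s)) has_real_derivative d) (at s) \<and>
     oct_k m n * q_f s powr (3 / 2) * (c * (X (n + 1) s + Y (n + 1) s)) =
       q_v s * q_f s / 4 * d + ((of_int n / 2 + 13 / 42) * p_e (s ^ 4) - q_vf' s / 56) *
         (c * (X n s + Y n s)) \<and>
     oct_a m n * q_f s powr (3 / 2) * (c * (X (n - 1) s + Y (n - 1) s)) =
       q_v s * q_f s / 4 * d - ((of_int n / 2 + 1 / 42) * p_e (s ^ 4) + q_vf' s / 56) *
         (c * (X n s + Y n s))"
    by (intro exI[of _ "c * (d + e)"] conjI DERIV_cmult DERIV_add lin lin' d e)
qed

text \<open>Each relation determines a neighbour from \<open>X n\<close> and its derivative, its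
  coefficient \<open>oct_k\<close> or \<open>oct_a\<close> being nonzero. Agreement of the
  \<open>n = 0\<close> members on an open set therefore spreads in both directions.\<close>

lemma octsys_unique:
  assumes S: "open S"
      and X: "\<And>s. s \<in> S \<Longrightarrow> octsys m X s" and Y: "\<And>s. s \<in> S \<Longrightarrow> octsys m Y s"
      and eq: "\<And>s. s \<in> S \<Longrightarrow> X 0 s = Y 0 s" and s: "s \<in> S"
  shows "X n s = Y n s"
proof -
  have step: "X (n + 1) s = Y (n + 1) s \<and> X (n - 1) s = Y (n - 1) s"
    if eq: "\<And>s. s \<in> S \<Longrightarrow> X n s = Y n s" and s: "s \<in> S" for n s
  proof -
    have ev: "\<forall>\<^sub>F t in nhds s. X n t = Y n t"
      using eventually_nhds_in_open[OF S s] by eventually_elim (rule eq)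
    obtain d where d: "(X n has_real_derivative d) (at s)"
     "oct_k m n * q_f s powr (3 / 2) * X (n + 1) s =
       q_v s * q_f s / 4 * d + ((of_int n / 2 + 13 / 42) * p_e (s ^ 4) - q_vf' s / 56) * X n s"
     "oct_a m n * q_f s powr (3 / 2) * X (n - 1) s =
       q_v s * q_f s / 4 * d - ((of_int n / 2 + 1 / 42) * p_e (s ^ 4) + q_vf' s / 56) * X n s"
      using X[OF s] unfolding octsys_def by blast
    obtain e where e: "(Y n has_real_derivative e) (at s)"
     "oct_k m n * q_f s powr (3 / 2) * Y (n + 1) s =
       q_v s * q_f s / 4 * e + ((of_int n / 2 + 13 / 42) * p_e (s ^ 4) - q_vf' s / 56) * Y n s"
     "oct_a m n * q_f s powr (3 / 2) * Y (n - 1) s =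
       q_v s * q_f s / 4 * e - ((of_int n / 2 + 1 / 42) * p_e (s ^ 4) + q_vf' s / 56) * Y n s"
      using Y[OF s] unfolding octsys_def by blast
    have "(X n has_real_derivative e) (at s)"
      using DERIV_cong_ev[OF refl ev refl] e(1) by blast
    with d(1) have "d = e" by (rule DERIV_unique)
    with d e eq[OF s]
    have "oct_k m n * q_f s powr (3 / 2) * X (n + 1) s = oct_k m n * q_f s powr (3 / 2) * Y (n + 1) s"
      "oct_a m n * q_f s powr (3 / 2) * X (n - 1) s = oct_a m n * q_f s powr (3 / 2) * Y (n - 1) s"
      by simp_all
    thus ?thesis
      using q_f_pos[of s] by (simp add: oct_k_nonzero oct_a_nonzero)
  qed
  have "\<forall>s\<in>S. X n s = Y n s"
    by (induction n rule: int_induct[where k = 0]) (use eq step in auto)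
  thus ?thesis using s by blast
qed

section \<open>The second solution and the half-turn that mixes the two\<close>

definition oct_B :: "(int \<Rightarrow> int \<Rightarrow> real \<Rightarrow> real) \<Rightarrow> int \<Rightarrow> int \<Rightarrow> real \<Rightarrow> real" where
  "oct_B r m n s = s * oct_A r m n (1 / s)"

lemma octsys_oct_B:
  assumes oct: "\<And>n m. octahedral_function n m (r n m)" and m: "m = 0 \<or> m = -1"
      and s: "0 < s" "s < 1"
  shows "octsys m (oct_B r m) s"
proof -
  have "octsys m (oct_A r m) (1 / s)"
    using s by (intro octsys_oct_A[of r, OF oct m]) auto
  from octsys_inverse[OF this s(1)] show ?thesis
    unfolding oct_B_def .
qed

lemma rotation_bounds:
  fixes s :: real
  assumes "0 < s" "s < 1"
  shows "0 < (1 - s) / (1 + s)" "(1 - s) / (1 + s) < 1"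
  using assms by simp_all

lemma oct_A_base_0:
  assumes oct: "\<And>n m. octahedral_function n m (r n m)"
  shows "oct_A r 0 0 s = 1"
  using octahedral_base_0[of r, OF oct] q_f_pos[of s] by (simp add: oct_A_def)

lemma oct_A_base_m1:
  assumes oct: "\<And>n m. octahedral_function n m (r n m)" and s: "s > 0" "s \<noteq> 1"
  shows "oct_A r (-1) 0 s = s ^ 2 * (1 + s ^ 4 / 7) / (1 - s ^ 4)"
proof -
  have "s ^ 4 \<noteq> 1" using s power4_eq_1_iff by blast
  thus ?thesis
    using octahedral_base_m1[of r, OF oct \<open>s ^ 4 \<noteq> 1\<close>] q_f_pos[of s]
    by (simp add: oct_A_def q_v_def power2_eq_square power3_eq_cube)
qed

lemma oct_A_rotate:
  assumes oct: "\<And>n m. octahedral_function n m (r n m)" and m: "m = 0 \<or> m = -1"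
      and s: "0 < s" "s < 1"
  shows "(1 + s) * oct_A r m n ((1 - s) / (1 + s)) = (-1) powi (n + m) * (oct_A r m n s + oct_B r m n s)"
proof -
  define c :: real where "c = (-1) powi m"
  have "(-1) powi n * ((1 + s) * oct_A r m n ((1 - s) / (1 + s))) = c * (oct_A r m n s + oct_B r m n s)"
  proof (rule octsys_unique[where S = "{0<..<1}" and m = m
        and X = "\<lambda>n s. (-1) powi n * ((1 + s) * oct_A r m n ((1 - s) / (1 + s)))"
        and Y = "\<lambda>n s. c * (oct_A r m n s + oct_B r m n s)"])
    fix s :: real assume "s \<in> {0<..<1}"
    hence s: "0 < s" "s < 1" by auto
    show "octsys m (\<lambda>n s. (-1) powi n * ((1 + s) * oct_A r m n ((1 - s) / (1 + s)))) s"
      using s rotation_bounds[OF s]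
      by (intro octsys_rotate octsys_oct_A[of r, OF oct m]) auto
    show "octsys m (\<lambda>n s. c * (oct_A r m n s + oct_B r m n s)) s"
      using s by (intro octsys_add octsys_oct_A[of r, OF oct m] octsys_oct_B[of r, OF oct m]) auto
    \<comment> \<open>For \<open>m = 0\<close> the two solutions are \<open>1\<close> and
      \<open>s\<close>, and both sides are \<open>1 + s\<close>; for \<open>m = -1\<close> the
      closed forms have to be compared.\<close>
    show "(-1) powi 0 * ((1 + s) * oct_A r m 0 ((1 - s) / (1 + s))) = c * (oct_A r m 0 s + oct_B r m 0 s)"
      using m
    proof
      assume "m = 0"
      thus ?thesis using oct_A_base_0[of r, OF oct] by (simp add: c_def oct_B_def)
    next
      assume m: "m = -1"
      define t where "t = (1 - s) / (1 + s)"
      have t: "0 < t" "t \<noteq> 1" using rotation_bounds[OF s] by (auto simp: t_def)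
      have s4: "s ^ 4 \<noteq> 1" using s power4_eq_1_iff[of s] by auto
      have B: "oct_B r (-1) 0 s = - (1 + 7 * s ^ 4) / (7 * s * (1 - s ^ 4))"
      proof -
        have "oct_B r (-1) 0 s = s * ((1 / s) ^ 2 * (1 + (1 / s) ^ 4 / 7) / (1 - (1 / s) ^ 4))"
          unfolding oct_B_def using s by (subst oct_A_base_m1[of r, OF oct]) auto
        also have "\<dots> = - (1 + 7 * s ^ 4) / (7 * s * (1 - s ^ 4))"
          using s s4 by (simp add: divide_simps) algebra
        finally show ?thesis .
      qed
      have A: "oct_A r (-1) 0 s = s ^ 3 * (7 + s ^ 4) / (7 * s * (1 - s ^ 4))"
        using s s4 by (subst oct_A_base_m1[of r, OF oct]) (auto simp: field_simps power_numeral_reduce)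
      have "(1 + s) * (t ^ 2 * (1 + t ^ 4 / 7) / (1 - t ^ 4)) =
          ((1 + 7 * s ^ 4) - s ^ 3 * (7 + s ^ 4)) / (7 * s * (1 - s ^ 4))"
      proof -
        have t4: "1 - t ^ 4 = 8 * s * (1 + s ^ 2) / (1 + s) ^ 4"
          using s unfolding t_def by (simp add: divide_simps) algebra
        have f: "t ^ 2 * (1 + t ^ 4 / 7) =
            (1 - s) ^ 2 * (7 * (1 + s) ^ 4 + (1 - s) ^ 4) / (7 * (1 + s) ^ 6)"
          using s unfolding t_def by (simp add: divide_simps)
        have "(1 + s) * (t ^ 2 * (1 + t ^ 4 / 7) / (1 - t ^ 4)) =
          (1 - s) ^ 2 * (7 * (1 + s) ^ 4 + (1 - s) ^ 4) / (56 * s * ((1 + s) * (1 + s ^ 2)))"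
        proof -
          have "x * (y / (7 * x ^ 6) / (8 * s * z / x ^ 4)) = y / (56 * s * (x * z))"
            if "x \<noteq> 0" for x y z :: real
            using that s by (simp add: divide_simps power_numeral_reduce)
          thus ?thesis unfolding t4 f using s by simp
        qed
        \<comment> \<open>Expanding by \<open>1 - s\<close> completes
          \<open>(1 + s) * (1 + s ^ 2)\<close> to the common denominator
          \<open>1 - s ^ 4\<close>.\<close>
        also have "\<dots> = ((1 - s) * ((1 - s) ^ 2 * (7 * (1 + s) ^ 4 + (1 - s) ^ 4))) /
            ((1 - s) * (56 * s * ((1 + s) * (1 + s ^ 2))))"
          using s by simp
        also have "(1 - s) * ((1 - s) ^ 2 * (7 * (1 + s) ^ 4 + (1 - s) ^ 4)) =
            8 * ((1 + 7 * s ^ 4) - s ^ 3 * (7 + s ^ 4))" by algebra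
        also have "(1 - s) * (56 * s * ((1 + s) * (1 + s ^ 2))) = 8 * (7 * s * (1 - s ^ 4))" by algebra
        finally show ?thesis by (rule trans) (rule mult_divide_mult_cancel_left, simp)
      qed
      hence At: "(1 + s) * oct_A r (-1) 0 t =
          ((1 + 7 * s ^ 4) - s ^ 3 * (7 + s ^ 4)) / (7 * s * (1 - s ^ 4))"
        using oct_A_base_m1[of r, OF oct t] by simp
      have signs: "(-1) powi 0 * ((x - y) / d) = - 1 * (y / d + - x / d)" for x y d :: real
        by (simp add: diff_divide_distrib)
      have "c = - 1" using m by (simp add: c_def)
      show ?thesis
        unfolding m t_def[symmetric] At A B \<open>c = - 1\<close> by (rule signs)
    qed
  qed (use s in auto)
  moreover have "(-1) powi n * ((-1) powi n * z) = (z :: real)" for z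
    by (simp flip: power_int_mult_distrib mult.assoc)
  ultimately show ?thesis
    unfolding c_def by (metis power_int_add mult.assoc zero_neq_neg_one)
qed

text \<open>The rotation is an involution, so \<open>oct_A_rotate\<close> can be applied at
  \<open>s\<close> and at \<open>t = (1 - s) / (1 + s)\<close>. The automorphy factors multiply to
  2, and the two instances can be solved for the value of \<open>oct_B\<close> at
  \<open>t\<close>.\<close>

lemma oct_B_rotate:
  assumes oct: "\<And>n m. octahedral_function n m (r n m)" and m: "m = 0 \<or> m = -1"
      and s: "0 < s" "s < 1"
  shows "(1 + s) * oct_B r m n ((1 - s) / (1 + s)) = (-1) powi (n + m) * (oct_A r m n s - oct_B r m n s)"
proof -
  define t e where "t = (1 - s) / (1 + s)" and "e = ((-1) powi (n + m) :: real)"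
  have t: "0 < t" "t < 1" using rotation_bounds[OF s] by (simp_all add: t_def)
  have tt: "(1 - t) / (1 + t) = s" "(1 + s) * (1 + t) = 2"
    using s by (simp_all add: t_def field_simps)
  have "e * e = 1" by (simp add: e_def flip: power_int_mult_distrib)
  have 1: "(1 + s) * oct_A r m n t = e * (oct_A r m n s + oct_B r m n s)"
    using oct_A_rotate[of r, OF oct m s] by (simp add: t_def e_def)
  have 2: "(1 + t) * oct_A r m n s = e * (oct_A r m n t + oct_B r m n t)"
    using oct_A_rotate[of r, OF oct m t] by (simp add: tt e_def)
  have "e * ((1 + s) * ((1 + t) * oct_A r m n s)) =
     (e * e) * ((1 + s) * oct_A r m n t + (1 + s) * oct_B r m n t)"
    unfolding 2 by (simp add: algebra_simps)
  hence "e * (2 * oct_A r m n s) = e * (oct_A r m n s + oct_B r m n s) + (1 + s) * oct_B r m n t"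
    using \<open>e * e = 1\<close> tt(2) 1 by (metis mult.assoc mult_1)
  thus ?thesis unfolding t_def[symmetric] e_def[symmetric] by (simp add: algebra_simps)
qed

text \<open>\<open>(1 + s) / (1 - s)\<close> is \<open>1 / t\<close> for the rotated point
  \<open>t\<close>, so inversion leads to \<open>oct_B\<close> at \<open>t\<close> and
  \<open>oct_B_rotate\<close> applies. The exponent \<open>1 + 12 * m + 12 * n\<close> of
  \<open>1 - s\<close> matches the automorphy factors of \<open>q_v\<close> and \<open>q_f\<close>;
  their constants 8 and 16 combine to powers of 64.\<close>

lemma second_factor:
  assumes oct: "\<And>n m. octahedral_function n m (r n m)" and m: "m = 0 \<or> m = -1"
      and s: "0 < s" "s < 1"
  shows "q_v s powi (- 2 * m) * q_f s powr (- 3 * of_int n / 2) *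
        (1 - s) powi (1 + 12 * m + 12 * n) * oct_tilde r n m ((1 + s) / (1 - s)) =
      64 powi (m + n) * (-1) powi (n + m) * (oct_A r m n s - oct_B r m n s)"
proof -
  define t j where "t = (1 - s) / (1 + s)" and "j = 1 - s"
  have j: "j > 0" using s by (simp add: j_def)
  \<comment> \<open>Replacing \<open>s\<close> by \<open>- s\<close> turns the rotation into this
    argument; \<open>q_f\<close> is even and \<open>q_v\<close> is odd.\<close>
  have qf: "q_f ((1 + s) / (1 - s)) = 16 * q_f s / j ^ 8"
    using q_rotate(2)[of "- s"] s by (simp add: j_def q_f_def)
  have qv: "q_v ((1 + s) / (1 - s)) = - 8 * q_v s / j ^ 6"
    using q_rotate(1)[of "- s"] s by (simp add: j_def q_v_def)
  have "16 powr (- 3 * of_int n / 2) = (4 powr 2) powr (- 3 * of_int n / 2 :: real)" by simp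
  also have "\<dots> = (4 powr 3) powr (of_int (- n))" unfolding powr_powr by simp
  also have "\<dots> = 64 powi (- n)"
    using powr_real_of_int'[of 64 "- n"] by simp
  finally have p16: "16 powr (- 3 * of_int n / 2) = (64 powi (- n) :: real)" .
  have pj: "(j ^ 8) powr (- 3 * of_int n / 2) = j powi (- 12 * n)"
    using j power8_powr[of j "- 3 * of_int n / 2"] powr_real_of_int'[of j "- 12 * n"] by simp
  have F: "q_f ((1 + s) / (1 - s)) powr (- 3 * of_int n / 2) =
      64 powi (- n) * q_f s powr (- 3 * of_int n / 2) / j powi (- 12 * n)"
    unfolding qf using q_f_pos[of s] j by (simp add: powr_divide powr_mult p16[simplified] pj[simplified])
  have V: "q_v ((1 + s) / (1 - s)) powi (- 2 * m) = 64 powi (- m) * q_v s powi (- 2 * m) / j powi (- 12 * m)"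
    using m unfolding qv by (auto simp: power_divide power_mult_distrib simp flip: power_mult)
  have inv: "64 powi (m + n) * (64 powi (- m) * 64 powi (- n)) = (1 :: real)"
    by (simp flip: power_int_add)
  have "64 powi (m + n) * (j * oct_A r m n ((1 + s) / (1 - s))) =
     (64 powi (m + n) * (64 powi (- m) * 64 powi (- n))) * (q_v s powi (- 2 * m) * q_f s powr (- 3 * of_int n / 2) *
        (j / (j powi (- 12 * m) * j powi (- 12 * n))) * oct_tilde r n m ((1 + s) / (1 - s)))"
    unfolding oct_A_def F V oct_tilde_def by simp
  also have "j / (j powi (- 12 * m) * j powi (- 12 * n)) = j powi (1 + 12 * m + 12 * n)"
    using j by (simp add: power_int_add power_int_minus field_simps)
  finally have "q_v s powi (- 2 * m) * q_f s powr (- 3 * of_int n / 2) *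
        j powi (1 + 12 * m + 12 * n) * oct_tilde r n m ((1 + s) / (1 - s)) =
      64 powi (m + n) * (j * oct_A r m n ((1 + s) / (1 - s)))"
    unfolding inv by simp
  also have "j * oct_A r m n ((1 + s) / (1 - s)) = (1 + s) * oct_B r m n t"
    using s by (simp add: oct_B_def t_def j_def)
  also have "\<dots> = (-1) powi (n + m) * (oct_A r m n s - oct_B r m n s)"
    using oct_B_rotate[of r, OF oct m s] by (simp add: t_def)
  finally show ?thesis by (simp add: j_def mult.assoc)
qed

subsection \<open>Wronskians and their limits at the vertices\<close>

text \<open>Local shape at the vertex 0: exponent \<open>e\<close> times a function smooth in
  \<open>s ^ 4\<close> near 0. Steps of four make Wronskians of functions with equal exponent small.
  The power of \<open>1 - s ^ 4\<close> is kept separate because it governs integrability at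
  \<open>s = 1\<close>.\<close>

definition vertex_form :: "int \<Rightarrow> int \<Rightarrow> (real \<Rightarrow> real) \<Rightarrow> bool" where
  "vertex_form e m f \<longleftrightarrow> (\<exists>\<beta> p. \<forall>s. 0 < s \<longrightarrow> s < 1 \<longrightarrow>
     f s = s powi e * ((1 - s ^ 4) powi m * (q_f s powr \<beta> * poly p (s ^ 4))))"

lemma oct_A_form:
  assumes oct: "\<And>n m. octahedral_function n m (r n m)" and m: "m = 0 \<or> m = -1"
  obtains p k where "int (degree p) \<le> 3 * n - m + 2 * int k"
    "\<And>s. s > 0 \<Longrightarrow> s \<noteq> 1 \<Longrightarrow> oct_A r m n s =
      s powi (- 2 * m) * ((1 - s ^ 4) powi m * (q_f s powr (- 3 * of_int n / 2 - real k) * poly p (s ^ 4)))"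
proof -
  obtain p k where deg: "int (degree p) \<le> 3 * n - m + 2 * int k" and
    form: "\<And>u. p_f u \<noteq> 0 \<Longrightarrow> u \<noteq> 1 \<Longrightarrow> r n m u = poly p u / (p_f u ^ k * (1 - u) ^ nat (- 3 * m))"
    using octahedral_form[of r m n, OF oct m] by auto
  have "oct_A r m n s =
      s powi (- 2 * m) * ((1 - s ^ 4) powi m * (q_f s powr (- 3 * of_int n / 2 - real k) * poly p (s ^ 4)))"
    if s: "s > 0" "s \<noteq> 1" for s
  proof -
    have s4: "s ^ 4 \<noteq> 1" using s power4_eq_1_iff by blast
    have qf: "q_f s > 0" by (rule q_f_pos)
    have R: "r n m (s ^ 4) = poly p (s ^ 4) / (q_f s ^ k * (1 - s ^ 4) ^ nat (- 3 * m))"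
      using form[OF _ s4] qf by (simp add: q_f_alt)
    have P: "q_f s powr (- 3 * of_int n / 2 - real k) = q_f s powr (- 3 * of_int n / 2) / q_f s ^ k"
      using qf powr_diff[of "q_f s" "- 3 * of_int n / 2" "real k"] by (simp add: powr_realpow)
    have Q: "q_v s powi (- 2 * m) / (1 - s ^ 4) ^ nat (- 3 * m) = s powi (- 2 * m) * (1 - s ^ 4) powi m"
      using m s4 by (auto simp: q_v_def power_mult_distrib power2_eq_square power3_eq_cube divide_simps)
    have "oct_A r m n s = (q_v s powi (- 2 * m) / (1 - s ^ 4) ^ nat (- 3 * m)) *
        ((q_f s powr (- 3 * of_int n / 2) / q_f s ^ k) * poly p (s ^ 4))"
      unfolding oct_A_def R by (simp add: mult_ac)
    thus ?thesis unfolding Q P by (simp only: mult.assoc)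
  qed
  with deg that show thesis by blast
qed

lemma vertex_form_oct_A:
  assumes oct: "\<And>n m. octahedral_function n m (r n m)" and m: "m = 0 \<or> m = -1"
  shows "vertex_form (- 2 * m) m (oct_A r m n)"
proof -
  obtain p k where
    "\<And>s. s > 0 \<Longrightarrow> s \<noteq> 1 \<Longrightarrow> oct_A r m n s =
      s powi (- 2 * m) * ((1 - s ^ 4) powi m * (q_f s powr (- 3 * of_int n / 2 - real k) * poly p (s ^ 4)))"
    using oct_A_form[of r m n, OF oct m] by metis
  thus ?thesis unfolding vertex_form_def
    by (intro exI[of _ "- 3 * of_int n / 2 - real k"] exI[of _ p]) auto
qed

text \<open>Behaviour at 0 is behaviour of \<open>oct_A\<close> at infinity. By the degree bound,
  \<open>u ^ D * poly p (1 / u)\<close> with \<open>D = 3 * n - m + 2 * k\<close> is again a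
  polynomial; the factor \<open>s\<close> to the power \<open>4 * (D + m)\<close> from
  \<open>q_f (1 / s)\<close> supplies \<open>u ^ D\<close> and leaves exactly the exponent
  \<open>1 + 2 * m\<close>.\<close>

lemma vertex_form_oct_B:
  assumes oct: "\<And>n m. octahedral_function n m (r n m)" and m: "m = 0 \<or> m = -1"
  shows "vertex_form (1 + 2 * m) m (oct_B r m n)"
proof -
  obtain p k where deg: "int (degree p) \<le> 3 * n - m + 2 * int k" and
    form: "\<And>s. s > 0 \<Longrightarrow> s \<noteq> 1 \<Longrightarrow> oct_A r m n s =
      s powi (- 2 * m) * ((1 - s ^ 4) powi m * (q_f s powr (- 3 * of_int n / 2 - real k) * poly p (s ^ 4)))"
    using oct_A_form[of r m n, OF oct m] by metis
  define \<beta> where "\<beta> = - 3 * of_int n / 2 - real k"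
  define D where "D = nat (3 * n - m + 2 * int k)"
  have D: "int D = 3 * n - m + 2 * int k" "degree p \<le> D"
    using deg by (auto simp: D_def)
  define p' where "p' = monom ((-1) powi m) (D - degree p) * reflect_poly p"
  have p': "poly p' u = (-1) powi m * (u ^ D * poly p (1 / u))" if "u \<noteq> 0" for u
    using that D(2) by (simp add: p'_def poly_monom poly_reflect_poly_nz divide_inverse flip: power_add mult.assoc)
  have "oct_B r m n s = s powi (1 + 2 * m) * ((1 - s ^ 4) powi m * (q_f s powr \<beta> * poly p' (s ^ 4)))"
    if s: "0 < s" "s < 1" for s
  proof -
    have s4: "s ^ 4 \<noteq> 1" using s power4_eq_1_iff[of s] by auto
    define v where "v = 1 - s ^ 4"
    have v: "v \<noteq> 0" using s4 by (simp add: v_def)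
    have "(s ^ 8) powr (- \<beta>) = s powr of_int (4 * (int D + m))"
    proof -
      have "8 * - \<beta> = of_int (4 * (int D + m))" by (simp add: \<beta>_def D(1))
      thus ?thesis using s power8_powr[of s "- \<beta>"] by simp
    qed
    also have "\<dots> = s powi (4 * (int D + m))"
      using s powr_real_of_int'[of s "4 * (int D + m)"] by simp
    also have "\<dots> = (s ^ 4) ^ D * s powi (4 * m)"
      using s by (simp add: power_int_add distrib_left power_int_mult)
    finally have pw: "(s ^ 8) powr (- \<beta>) = (s ^ 4) ^ D * s powi (4 * m)" .
    have qf: "q_f (1 / s) powr \<beta> = q_f s powr \<beta> * ((s ^ 4) ^ D * s powi (4 * m))"
    proof -
      have "q_f (1 / s) powr \<beta> = q_f s powr \<beta> * (s ^ 8) powr (- \<beta>)"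
        using s q_f_pos[of s] by (subst q_inverse(2)) (simp_all add: powr_divide powr_minus field_simps)
      thus ?thesis unfolding pw .
    qed
    have one: "1 - (1 / s) ^ 4 = - v / s ^ 4"
      using s by (simp add: v_def field_simps)
    have "1 / s > 0" "1 / s \<noteq> 1" using s by auto
    note form[OF this, folded \<beta>_def, unfolded one qf]
    hence "oct_B r m n s = s * ((1 / s) powi (- 2 * m) * ((- v / s ^ 4) powi m *
        (q_f s powr \<beta> * ((s ^ 4) ^ D * s powi (4 * m)) * poly p ((1 / s) ^ 4))))"
      unfolding oct_B_def by simp
    also have "(1 / s) ^ 4 = 1 / s ^ 4" by (simp add: power_divide)
    also have "s * ((1 / s) powi (- 2 * m) * ((- v / s ^ 4) powi m *
        (q_f s powr \<beta> * ((s ^ 4) ^ D * s powi (4 * m)) * poly p (1 / s ^ 4)))) =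
      s powi (1 + 2 * m) * (v powi m * (q_f s powr \<beta> * ((-1) powi m * ((s ^ 4) ^ D * poly p (1 / s ^ 4)))))"
      using m s v by (auto simp: field_simps power_numeral_reduce power_int_minus)
    also have "(-1) powi m * ((s ^ 4) ^ D * poly p (1 / s ^ 4)) = poly p' (s ^ 4)"
      using s by (subst p') auto
    finally show ?thesis by (simp add: v_def)
  qed
  thus ?thesis unfolding vertex_form_def by blast
qed

definition wronskian :: "(real \<Rightarrow> real) \<Rightarrow> (real \<Rightarrow> real) \<Rightarrow> real \<Rightarrow> real" where
  "wronskian f g s = deriv f s * g s - f s * deriv g s"

lemma vertex_formE:
  assumes "vertex_form e m f"
  obtains \<Phi> \<Phi>' where "\<And>s. 0 < s \<Longrightarrow> s < 1 \<Longrightarrow> f s = s powi e * \<Phi> (s ^ 4)"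
    "\<And>s. 0 < s \<Longrightarrow> s < 1 \<Longrightarrow> deriv f s = s powi (e - 1) * (of_int e * \<Phi> (s ^ 4) + 4 * s ^ 4 * \<Phi>' (s ^ 4))"
    "isCont \<Phi> 0" "isCont \<Phi>' 0"
proof -
  obtain \<beta> p where f: "\<And>s. 0 < s \<Longrightarrow> s < 1 \<Longrightarrow>
     f s = s powi e * ((1 - s ^ 4) powi m * (q_f s powr \<beta> * poly p (s ^ 4)))"
    using assms unfolding vertex_form_def by metis
  define \<Phi> where "\<Phi> u = (1 - u) powi m * (p_f u powr \<beta> * poly p u)" for u
  \<comment> \<open>The derivative of \<open>\<Phi>\<close>, written out so that its continuity at 0
    is visible.\<close>
  define \<Phi>' where "\<Phi>' u = (of_int m * (1 - u) powi (m - 1) * - 1) * (p_f u powr \<beta> * poly p u) +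
    ((\<beta> * p_f u powr (\<beta> - 1) * (14 + 2 * u)) * poly p u + poly (pderiv p) u * p_f u powr \<beta>) * (1 - u) powi m" for u
  have D\<Phi>: "(\<Phi> has_real_derivative \<Phi>' u) (at u)" if "0 \<le> u" "u < 1" for u
  proof -
    have 1: "((\<lambda>u. (1 - u) powi m) has_real_derivative of_int m * (1 - u) powi (m - 1) * - 1) (at u)"
      using that by (auto intro!: derivative_eq_intros)
    have 2: "((\<lambda>u. p_f u powr \<beta>) has_real_derivative \<beta> * p_f u powr (\<beta> - 1) * (14 + 2 * u)) (at u)"
      by (rule DERIV_chain2[OF has_real_derivative_powr DERIV_p_f]) (use p_f_nonzero_pos that in auto)
    show ?thesis
      unfolding \<Phi>_def \<Phi>'_def by (rule DERIV_mult[OF 1 DERIV_mult[OF 2 poly_DERIV]])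
  qed
  have eq: "f s = s powi e * \<Phi> (s ^ 4)" if "0 < s" "s < 1" for s
    using f[OF that] by (simp add: \<Phi>_def q_f_alt)
  show thesis
  proof (rule that[OF eq])
    fix s :: real assume s: "0 < s" "s < 1"
    have "s ^ 4 < 1" using s by (simp add: power_less_one_iff)
    have 1: "((\<lambda>s. s powi e) has_real_derivative of_int e * s powi (e - 1)) (at s)"
      using s by (auto intro!: derivative_eq_intros)
    have 2: "((\<lambda>s. s ^ 4) has_real_derivative 4 * s ^ 3) (at s)"
      by (auto intro!: derivative_eq_intros)
    have "((\<lambda>s. s powi e * \<Phi> (s ^ 4)) has_real_derivative
       of_int e * s powi (e - 1) * \<Phi> (s ^ 4) + \<Phi>' (s ^ 4) * (4 * s ^ 3) * s powi e) (at s)"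
      by (rule DERIV_mult[OF 1 DERIV_chain2[OF D\<Phi> 2]]) (use \<open>s ^ 4 < 1\<close> in auto)
    moreover have "\<forall>\<^sub>F t in nhds s. s \<in> {0<..<1} \<longrightarrow> t \<in> {0<..<1}"
      using s by (auto intro: eventually_mono[OF eventually_nhds_in_open[of "{0<..<1}" s]])
    hence "\<forall>\<^sub>F t in nhds s. t powi e * \<Phi> (t ^ 4) = f t"
      by eventually_elim (use s eq in auto)
    ultimately have "(f has_real_derivative
       of_int e * s powi (e - 1) * \<Phi> (s ^ 4) + \<Phi>' (s ^ 4) * (4 * s ^ 3) * s powi e) (at s)"
      using DERIV_cong_ev[of s s "\<lambda>s. s powi e * \<Phi> (s ^ 4)" f] by blast
    moreover have "s powi e = s powi (e - 1) * s"
      using s power_int_add[of s "e - 1" 1] by simp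
    ultimately show "deriv f s = s powi (e - 1) * (of_int e * \<Phi> (s ^ 4) + 4 * s ^ 4 * \<Phi>' (s ^ 4))"
      by (simp add: DERIV_imp_deriv algebra_simps power_numeral_reduce)
  next
    show "isCont \<Phi> 0" using D\<Phi>[of 0] DERIV_isCont by simp
    show "isCont \<Phi>' 0" unfolding \<Phi>'_def p_f_def
      by (intro continuous_intros) auto
  qed
qed

text \<open>The leading terms combine with the factor \<open>e - e'\<close>, and the derivatives of
  the functions of \<open>s ^ 4\<close> contribute only at relative order \<open>s ^ 4\<close>. For
  \<open>e + e' = 1\<close> this leaves a finite limit at 0; for \<open>e = e'\<close> the leading
  term is gone.\<close>

lemma wronskian_vertex_form:
  assumes f: "vertex_form e m f" and g: "vertex_form e' m g"
  obtains \<Phi> \<Psi> where "isCont \<Phi> 0" "isCont \<Psi> 0"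
    "\<And>s. 0 < s \<Longrightarrow> s < 1 \<Longrightarrow> wronskian f g s =
       s powi (e + e' - 1) * (of_int (e - e') * \<Phi> (s ^ 4) + s ^ 4 * \<Psi> (s ^ 4))"
proof -
  obtain F F' where F: "\<And>s. 0 < s \<Longrightarrow> s < 1 \<Longrightarrow> f s = s powi e * F (s ^ 4)"
    "\<And>s. 0 < s \<Longrightarrow> s < 1 \<Longrightarrow> deriv f s = s powi (e - 1) * (of_int e * F (s ^ 4) + 4 * s ^ 4 * F' (s ^ 4))"
    "isCont F 0" "isCont F' 0"
    using vertex_formE[OF f] by metis
  obtain G G' where G: "\<And>s. 0 < s \<Longrightarrow> s < 1 \<Longrightarrow> g s = s powi e' * G (s ^ 4)"
    "\<And>s. 0 < s \<Longrightarrow> s < 1 \<Longrightarrow> deriv g s = s powi (e' - 1) * (of_int e' * G (s ^ 4) + 4 * s ^ 4 * G' (s ^ 4))"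
    "isCont G 0" "isCont G' 0"
    using vertex_formE[OF g] by metis
  show thesis
  proof (rule that)
    show "isCont (\<lambda>u. F u * G u) 0" using F G by (intro continuous_intros)
    show "isCont (\<lambda>u. 4 * (F' u * G u - F u * G' u)) 0" using F G by (intro continuous_intros)
    fix s :: real assume s: "0 < s" "s < 1"
    define P Q where "P = s powi (e - 1)" and "Q = s powi (e' - 1)"
    have pw: "s powi e = P * s" "s powi e' = Q * s" "s powi (e + e' - 1) = P * Q * s"
      using s power_int_add[of s "e - 1" 1] power_int_add[of s "e' - 1" 1]
        power_int_add[of s "e - 1" e'] by (simp_all add: P_def Q_def algebra_simps)
    show "wronskian f g s = s powi (e + e' - 1) *
       (of_int (e - e') * (F (s ^ 4) * G (s ^ 4)) + s ^ 4 * (4 * (F' (s ^ 4) * G (s ^ 4) - F (s ^ 4) * G' (s ^ 4))))"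
      unfolding wronskian_def F(1,2)[OF s] G(1,2)[OF s] pw P_def[symmetric] Q_def[symmetric]
      by (simp add: algebra_simps)
  qed
qed

lemma isCont_power4_at_right:
  assumes "isCont (\<Phi> :: real \<Rightarrow> real) 0"
  shows "((\<lambda>s. \<Phi> (s ^ 4)) \<longlongrightarrow> \<Phi> 0) (at_right 0)"
proof -
  have "isCont (\<lambda>s. \<Phi> (s ^ 4)) 0"
    by (rule isCont_o2[where g = \<Phi> and f = "\<lambda>s. s ^ 4"]) (use assms in auto)
  hence "((\<lambda>s. \<Phi> (s ^ 4)) \<longlongrightarrow> \<Phi> 0) (at 0)" by (simp add: isCont_def)
  thus ?thesis by (rule filterlim_mono) (auto simp: at_le)
qed

lemma wronskian_vertex_form_limit:
  assumes f: "vertex_form e m f" and g: "vertex_form e' m g" and e: "e + e' = 1"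
  obtains L where "(wronskian f g \<longlongrightarrow> L) (at_right 0)"
proof -
  obtain \<Phi> \<Psi> where c: "isCont \<Phi> 0" "isCont \<Psi> 0" and
    w: "\<And>s. 0 < s \<Longrightarrow> s < 1 \<Longrightarrow> wronskian f g s =
       s powi (e + e' - 1) * (of_int (e - e') * \<Phi> (s ^ 4) + s ^ 4 * \<Psi> (s ^ 4))"
    using wronskian_vertex_form[OF f g] by metis
  have "((\<lambda>s. of_int (e - e') * \<Phi> (s ^ 4) + s ^ 4 * \<Psi> (s ^ 4)) \<longlongrightarrow>
      of_int (e - e') * \<Phi> 0 + 0 ^ 4 * \<Psi> 0) (at_right 0)"
    by (intro tendsto_intros isCont_power4_at_right c)
  moreover have "\<forall>\<^sub>F s in at_right 0. of_int (e - e') * \<Phi> (s ^ 4) + s ^ 4 * \<Psi> (s ^ 4) = wronskian f g s"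
    using eventually_at_right_real[of 0 "1 :: real", simplified]
    by eventually_elim (use w e in auto)
  ultimately show thesis using that Lim_transform_eventually by blast
qed

text \<open>Without the leading term the order at 0 is \<open>(2 * e - 1) + 4 = 2 * e + 3\<close>,
  which is positive because \<open>e >= -1\<close>.\<close>

lemma wronskian_vertex_form_same:
  assumes f: "vertex_form e m f" and g: "vertex_form e m g" and e: "e \<ge> -1"
  shows "(wronskian f g \<longlongrightarrow> 0) (at_right 0)"
proof -
  obtain \<Phi> \<Psi> where c: "isCont \<Phi> 0" "isCont \<Psi> 0" and
    w: "\<And>s. 0 < s \<Longrightarrow> s < 1 \<Longrightarrow> wronskian f g s =
       s powi (e + e - 1) * (of_int (e - e) * \<Phi> (s ^ 4) + s ^ 4 * \<Psi> (s ^ 4))"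
    using wronskian_vertex_form[OF f g] by metis
  have "((\<lambda>s. s ^ nat (2 * e + 3) * \<Psi> (s ^ 4)) \<longlongrightarrow> 0 ^ nat (2 * e + 3) * \<Psi> 0) (at_right 0)"
    by (intro tendsto_intros isCont_power4_at_right c)
  hence "((\<lambda>s. s ^ nat (2 * e + 3) * \<Psi> (s ^ 4)) \<longlongrightarrow> 0) (at_right 0)"
    using e by (simp add: zero_power)
  moreover have "\<forall>\<^sub>F s in at_right 0. s ^ nat (2 * e + 3) * \<Psi> (s ^ 4) = wronskian f g s"
    using eventually_at_right_real[of 0 "1 :: real", simplified]
  proof eventually_elim
    case (elim s)
    have "s ^ nat (2 * e + 3) = s powi (2 * e + 3)"
      using e by (simp add: power_int_def)
    also have "\<dots> = s powi (e + e - 1) * s ^ 4"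
      using elim power_int_add[of s "e + e - 1" 4] by (simp add: add.commute)
    finally show ?case using elim w[of s] by simp
  qed
  ultimately show ?thesis by (rule Lim_transform_eventually)
qed

text \<open>The weight contains \<open>s ^ 2 * (1 - s ^ 4) ^ 2\<close>, which compensates a pole of
  order two at either end. So the product extends continuously to the closed interval, and
  integrability follows.\<close>

lemma vertex_form_product:
  assumes f: "vertex_form e m f" and g: "vertex_form e' m g" and e: "e + e' \<ge> -2" and m: "m \<ge> -1"
  obtains C where "continuous_on {0..1} C"
    "\<And>s. 0 < s \<Longrightarrow> s < 1 \<Longrightarrow> C s = f s * g s * (q_v s ^ 2 / q_f s ^ 2)"
proof -
  obtain \<beta> p where f: "\<And>s. 0 < s \<Longrightarrow> s < 1 \<Longrightarrow>
     f s = s powi e * ((1 - s ^ 4) powi m * (q_f s powr \<beta> * poly p (s ^ 4)))"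
    using f unfolding vertex_form_def by metis
  obtain \<gamma> q where g: "\<And>s. 0 < s \<Longrightarrow> s < 1 \<Longrightarrow>
     g s = s powi e' * ((1 - s ^ 4) powi m * (q_f s powr \<gamma> * poly q (s ^ 4)))"
    using g unfolding vertex_form_def by metis
  define C where "C s = s ^ nat (e + e' + 2) * (1 - s ^ 4) ^ nat (2 * m + 2) *
     (q_f s powr \<beta> * poly p (s ^ 4)) * (q_f s powr \<gamma> * poly q (s ^ 4)) / q_f s ^ 2" for s
  have qf: "q_f s \<noteq> 0" for s using q_f_pos[of s] by simp
  have "continuous_on {0..1} q_f" unfolding q_f_def by (intro continuous_intros)
  hence "continuous_on {0..1} C"
    unfolding C_def by (intro continuous_intros) (use qf in auto)
  moreover have "C s = f s * g s * (q_v s ^ 2 / q_f s ^ 2)" if s: "0 < s" "s < 1" for s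
  proof -
    define v where "v = 1 - s ^ 4"
    have v: "v \<noteq> 0" using s power4_eq_1_iff[of s] by (auto simp: v_def)
    have 1: "s ^ nat (e + e' + 2) = s powi e * s powi e' * s ^ 2"
    proof -
      have "s ^ nat (e + e' + 2) = s powi (e + e' + 2)" using e by (simp add: power_int_def)
      moreover have "s powi (e + e' + 2) = s powi e * s powi e' * s powi 2"
        using s power_int_add[of s] by simp
      ultimately show ?thesis by simp
    qed
    have 2: "v ^ nat (2 * m + 2) = v powi m * v powi m * v ^ 2"
    proof -
      have "v ^ nat (2 * m + 2) = v powi (m + m + 2)" using m by (simp add: power_int_def)
      also have "\<dots> = v powi m * v powi m * v powi 2"
        unfolding power_int_add[OF disjI1[OF v]] ..
      finally show ?thesis by simp
    qed
    have 3: "q_v s ^ 2 = s ^ 2 * v ^ 2" by (simp add: q_v_def v_def power_mult_distrib)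
    show ?thesis
      unfolding C_def f[OF s] g[OF s] v_def[symmetric] 1 2 3 by simp
  qed
  ultimately show thesis by (rule that)
qed

lemma wronskian_add_left:
  assumes "f differentiable (at s)" "g differentiable (at s)"
  shows "wronskian (\<lambda>s. f s + g s) h s = wronskian f h s + wronskian g h s"
proof -
  have "deriv (\<lambda>s. f s + g s) s = deriv f s + deriv g s"
    using assms by (intro DERIV_imp_deriv DERIV_add) (auto simp: DERIV_deriv_iff_real_differentiable)
  thus ?thesis by (simp add: wronskian_def algebra_simps)
qed

lemma wronskian_diff_right:
  assumes "f differentiable (at s)" "g differentiable (at s)"
  shows "wronskian h (\<lambda>s. f s - g s) s = wronskian h f s - wronskian h g s"
proof -
  have "deriv (\<lambda>s. f s - g s) s = deriv f s - deriv g s"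
    using assms by (intro DERIV_imp_deriv DERIV_diff) (auto simp: DERIV_deriv_iff_real_differentiable)
  note deriv = this
  show ?thesis unfolding wronskian_def deriv by (simp add: algebra_simps)
qed

text \<open>The contributions of the derivative of \<open>1 + s\<close> cancel, and
  \<open>(1 + s) ^ 2\<close> times the derivative of the rotation is the constant -2. So Wronskians
  are carried along without a variable factor.\<close>

lemma wronskian_rotate:
  assumes f: "\<And>s. 0 < s \<Longrightarrow> s < 1 \<Longrightarrow> f s = a * ((1 + s) * F ((1 - s) / (1 + s)))"
      and g: "\<And>s. 0 < s \<Longrightarrow> s < 1 \<Longrightarrow> g s = b * ((1 + s) * G ((1 - s) / (1 + s)))"
      and F: "F differentiable (at ((1 - s) / (1 + s)))" and G: "G differentiable (at ((1 - s) / (1 + s)))"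
      and s: "0 < s" "s < 1"
  shows "wronskian f g s = - 2 * a * b * wronskian F G ((1 - s) / (1 + s))"
proof -
  define t where "t = (1 - s) / (1 + s)"
  have D: "deriv f s = a * (F t - 2 * deriv F t / (1 + s))"
    if f: "\<And>s. 0 < s \<Longrightarrow> s < 1 \<Longrightarrow> f s = a * ((1 + s) * F ((1 - s) / (1 + s)))"
      and F: "F differentiable (at t)" for f F and a :: real
  proof -
    have 1: "((\<lambda>s. (1 - s) / (1 + s)) has_real_derivative - 2 / (1 + s) ^ 2) (at s)"
      using s by (auto intro!: derivative_eq_intros simp: power2_eq_square)
    have 2: "((\<lambda>s. 1 + s) has_real_derivative 1) (at s)"
      by (auto intro!: derivative_eq_intros)
    have 3: "(F has_real_derivative deriv F t) (at ((1 - s) / (1 + s)))"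
      using F by (simp add: t_def DERIV_deriv_iff_real_differentiable)
    have "((\<lambda>s. a * ((1 + s) * F ((1 - s) / (1 + s)))) has_real_derivative
      a * (1 * F ((1 - s) / (1 + s)) + deriv F t * (- 2 / (1 + s) ^ 2) * (1 + s))) (at s)"
      by (rule DERIV_cmult[OF DERIV_mult[OF 2 DERIV_chain2[OF 3 1]]])
    moreover have ev: "\<forall>\<^sub>F x in nhds s. a * ((1 + x) * F ((1 - x) / (1 + x))) = f x"
      using eventually_nhds_in_open[of "{0<..<1}" s] s by (auto elim!: eventually_mono simp: f)
    ultimately have "(f has_real_derivative
      a * (1 * F ((1 - s) / (1 + s)) + deriv F t * (- 2 / (1 + s) ^ 2) * (1 + s))) (at s)"
      using DERIV_cong_ev[OF refl ev refl] by blast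
    thus ?thesis
      using s by (simp add: DERIV_imp_deriv t_def power2_eq_square)
  qed
  have Df: "deriv f s = a * (F t - 2 * deriv F t / (1 + s))"
    by (rule D[OF _ F[folded t_def]]) (rule f)
  have Dg: "deriv g s = b * (G t - 2 * deriv G t / (1 + s))"
    by (rule D[OF _ G[folded t_def]]) (rule g)
  have "a * (x - 2 * x' / j) * (b * (j * y)) - a * (j * x) * (b * (y - 2 * y' / j)) =
      - 2 * a * b * (x' * y - x * y')" if "j \<noteq> 0" for x x' y y' j :: real
    using that by (simp add: field_simps)
  thus ?thesis
    unfolding wronskian_def Df Dg f[OF s] g[OF s] t_def[symmetric] using s by simp
qed

lemma filterlim_rotate_at_left_1:
  "filterlim (\<lambda>s::real. (1 - s) / (1 + s)) (at_right 0) (at_left 1)"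
proof -
  have "((\<lambda>s::real. (1 - s) / (1 + s)) \<longlongrightarrow> (1 - 1) / (1 + 1)) (at_left 1)"
    by (intro tendsto_intros) auto
  moreover have "\<forall>\<^sub>F s in at_left (1::real). (1 - s) / (1 + s) > 0"
    using eventually_at_left_real[of 0 "1::real", simplified] by eventually_elim auto
  ultimately show ?thesis
    by (intro tendsto_imp_filterlim_at_right) simp_all
qed

section \<open>The Wronskian as an antiderivative of the integrand\<close>

theorem theorem7p1:
  fixes r :: "int \<Rightarrow> int \<Rightarrow> real \<Rightarrow> real" and m n n' :: int
  assumes "\<And>n m. octahedral_function n m (r n m)"
    and "m = 0 \<or> m = -1"
    and "n \<noteq> n'" and "even (n - n')"
  shows "set_integrable lborel {0..1} (oct_integrand r m n n')
       \<and> (LBINT s:{0..1}. oct_integrand r m n n' s) = 0"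
proof -
  note oct = assms(1) and m = assms(2)
  define A A' B B' where "A = oct_A r m n" and "A' = oct_A r m n'"
    and "B = oct_B r m n" and "B' = oct_B r m n'"
  define y where "y s = A' s - B' s" for s
  define e :: real where "e = (-1) powi (n' + m)"
  have e: "e * e = 1" by (simp add: e_def flip: power_int_mult_distrib)
  \<comment> \<open>Parity enters here: the signs that the rotation attaches to \<open>n\<close> and
    \<open>n'\<close> agree.\<close>
  have en: "(-1) powi (n + m) = e"
  proof -
    obtain j where "n - n' = 2 * j" using assms(4) by blast
    hence "n + m = (n' + m) + 2 * j" by simp
    thus ?thesis by (simp add: e_def power_int_add power_int_mult)
  qed
  have second: "(deriv (oct_A r m k) has_real_derivative oct_pot m k s * oct_A r m k s) (at s)"
    "(deriv (oct_B r m k) has_real_derivative oct_pot m k s * oct_B r m k s) (at s)"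
    "oct_A r m k differentiable (at s)" "oct_B r m k differentiable (at s)"
    if s: "0 < s" "s < 1" for k s
  proof -
    have qv: "q_v s \<noteq> 0" if "s \<in> {0<..<1}" for s
      using that q_v_pos[of s] by simp
    have sysA: "octsys m (oct_A r m) s" and sysB: "octsys m (oct_B r m) s" if "s \<in> {0<..<1}" for s
      using that by (auto intro!: octsys_oct_A[of r, OF oct m] octsys_oct_B[of r, OF oct m])
    show "(deriv (oct_A r m k) has_real_derivative oct_pot m k s * oct_A r m k s) (at s)"
      "(deriv (oct_B r m k) has_real_derivative oct_pot m k s * oct_B r m k s) (at s)"
      by (rule octsys_second_derivative[of "{0<..<1}"]; use s sysA sysB qv in auto)+
    show "oct_A r m k differentiable (at s)" "oct_B r m k differentiable (at s)"
      using sysA[of s] sysB[of s] s unfolding octsys_def real_differentiable_def by auto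
  qed
  note defs = A_def A'_def B_def B'_def
  have forms: "vertex_form (- 2 * m) m A" "vertex_form (- 2 * m) m A'"
    "vertex_form (1 + 2 * m) m B" "vertex_form (1 + 2 * m) m B'"
    unfolding defs by (intro vertex_form_oct_A[of r, OF oct m] vertex_form_oct_B[of r, OF oct m])+
  have ms: "- 2 * m + - 2 * m \<ge> - 2" "- 2 * m + (1 + 2 * m) \<ge> - 2" "m \<ge> - 1"
    "- 2 * m \<ge> - 1" "1 + 2 * m \<ge> - 1" "- 2 * m + (1 + 2 * m) = 1"
    using m by auto
  define I where "I s = A s * y s * (q_v s ^ 2 / q_f s ^ 2)" for s
  obtain C1 where C1: "continuous_on {0..1} C1"
    "\<And>s. 0 < s \<Longrightarrow> s < 1 \<Longrightarrow> C1 s = A s * A' s * (q_v s ^ 2 / q_f s ^ 2)"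
    using vertex_form_product[OF forms(1,2) ms(1,3)] by blast
  obtain C2 where C2: "continuous_on {0..1} C2"
    "\<And>s. 0 < s \<Longrightarrow> s < 1 \<Longrightarrow> C2 s = A s * B' s * (q_v s ^ 2 / q_f s ^ 2)"
    using vertex_form_product[OF forms(1,4) ms(2,3)] by blast
  define C where "C s = C1 s - C2 s" for s
  have C: "continuous_on {0..1} C" "\<And>s. 0 < s \<Longrightarrow> s < 1 \<Longrightarrow> C s = I s"
    unfolding C_def using C1 C2
    by (auto intro: continuous_on_diff simp: I_def y_def right_diff_distrib left_diff_distrib diff_divide_distrib)
  define K where "K = 64 powi (m + n') * e"
  have integrand: "oct_integrand r m n n' s = K * C s" if s: "0 < s" "s < 1" for s
    unfolding oct_integrand_def second_factor[of r, OF oct m s] C(2)[OF s]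
    by (simp add: I_def y_def K_def e_def defs oct_A_def oct_tilde_def)
  define h where "h = wronskian A y"
  \<comment> \<open>This is -144 times the difference of \<open>n * (3 * n + 2)\<close> and
    \<open>n' * (3 * n' + 2)\<close>, factored. The second factor is 2 modulo 3, so the constant is
    nonzero for distinct indices and \<open>h\<close> can be divided by it.\<close>
  define c0 :: real where "c0 = of_int (- 144 * (n - n') * (3 * (n + n') + 2))"
  have "3 * (n + n') + 2 \<noteq> 0" by presburger
  hence c0: "c0 \<noteq> 0" using assms(3) unfolding c0_def by simp
  have Dh: "(h has_real_derivative c0 * C s) (at s)" if s: "0 < s" "s < 1" for s
  proof -
    have Dy: "deriv y s = deriv A' s - deriv B' s" if "0 < s" "s < 1" for s
      unfolding y_def defs using second(3,4)[OF that]
      by (intro DERIV_imp_deriv DERIV_diff) (auto simp: DERIV_deriv_iff_real_differentiable)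
    have h: "h s = deriv A s * y s - A s * (deriv A' s - deriv B' s)" if "0 < s" "s < 1" for s
      unfolding h_def wronskian_def Dy[OF that] ..
    have D: "(A has_real_derivative deriv A s) (at s)" "(A' has_real_derivative deriv A' s) (at s)"
        "(B' has_real_derivative deriv B' s) (at s)"
      using second(3,4)[OF s] unfolding defs DERIV_deriv_iff_real_differentiable by auto
    have "((\<lambda>s. deriv A s * y s - A s * (deriv A' s - deriv B' s)) has_real_derivative
       (oct_pot m n s * A s) * y s + (deriv A' s - deriv B' s) * deriv A s -
       (deriv A s * (deriv A' s - deriv B' s) + (oct_pot m n' s * A' s - oct_pot m n' s * B' s) * A s)) (at s)"
      unfolding y_def by (intro DERIV_diff DERIV_mult D second[OF s, folded defs] second(1,2)[OF s, of n', folded defs]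
          second(1)[OF s, of n, folded defs])
    also have "(oct_pot m n s * A s) * y s + (deriv A' s - deriv B' s) * deriv A s -
       (deriv A s * (deriv A' s - deriv B' s) + (oct_pot m n' s * A' s - oct_pot m n' s * B' s) * A s) =
       (oct_pot m n s - oct_pot m n' s) * (A s * y s)"
      by (simp add: y_def algebra_simps)
    \<comment> \<open>The parts of the potentials that do not depend on the lower index cancel; the
      rest is a multiple of the weight.\<close>
    also have "oct_pot m n s - oct_pot m n' s = c0 * (q_v s ^ 2 / q_f s ^ 2)"
      using q_v_pos[OF s] q_f_pos[of s] unfolding oct_pot_def diff_divide_distrib[symmetric]
      by (simp add: c0_def divide_simps) (simp add: algebra_simps power_numeral_reduce)
    also have "c0 * (q_v s ^ 2 / q_f s ^ 2) * (A s * y s) = c0 * C s"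
      by (simp add: C(2)[OF s] I_def)
    finally have 1: "((\<lambda>s. deriv A s * y s - A s * (deriv A' s - deriv B' s)) has_real_derivative c0 * C s) (at s)" .
    have ev: "\<forall>\<^sub>F x in nhds s. deriv A x * y x - A x * (deriv A' x - deriv B' x) = h x"
      using eventually_nhds_in_open[of "{0<..<1}" s] s by (auto elim!: eventually_mono simp: h)
    show ?thesis using DERIV_cong_ev[OF refl ev refl] 1 by blast
  qed
  obtain L where L: "(wronskian A B' \<longlongrightarrow> L) (at_right 0)"
    using wronskian_vertex_form_limit[OF forms(1,4) ms(6)] by blast
  have lim0: "(h \<longlongrightarrow> - L) (at_right 0)"
  proof -
    have "(wronskian A A' \<longlongrightarrow> 0) (at_right 0)"
      by (rule wronskian_vertex_form_same[OF forms(1,2) ms(4)])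
    hence "((\<lambda>s. wronskian A A' s - wronskian A B' s) \<longlongrightarrow> 0 - L) (at_right 0)"
      by (intro tendsto_diff L)
    moreover have "\<forall>\<^sub>F s in at_right 0. wronskian A A' s - wronskian A B' s = h s"
      using eventually_at_right_real[of 0 "1 :: real", simplified]
    proof eventually_elim
      case (elim s)
      thus ?case unfolding h_def y_def
        by (subst wronskian_diff_right) (auto simp: second defs)
    qed
    ultimately show ?thesis using Lim_transform_eventually by fastforce
  qed
  have lim1: "(h \<longlongrightarrow> - L) (at_left 1)"
  proof -
    have "(wronskian B B' \<longlongrightarrow> 0) (at_right 0)"
      by (rule wronskian_vertex_form_same[OF forms(3,4) ms(5)])
    hence "((\<lambda>t. - (wronskian A B' t + wronskian B B' t)) \<longlongrightarrow> - (L + 0)) (at_right 0)"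
      by (intro tendsto_minus tendsto_add L)
    from filterlim_compose[OF this filterlim_rotate_at_left_1]
    have "((\<lambda>s. - (wronskian A B' ((1 - s) / (1 + s)) + wronskian B B' ((1 - s) / (1 + s)))) \<longlongrightarrow> - L) (at_left 1)"
      by simp
    moreover have "\<forall>\<^sub>F s in at_left 1. - (wronskian A B' ((1 - s) / (1 + s)) + wronskian B B' ((1 - s) / (1 + s))) = h s"
      using eventually_at_left_real[of 0 "1 :: real", simplified]
    proof eventually_elim
      case (elim s)
      hence s: "0 < s" "s < 1" by auto
      \<comment> \<open>The factor \<open>e / 2\<close> comes from solving the rotation formula at
        \<open>t\<close> for \<open>A s\<close>, with \<open>(1 + s) * (1 + t) = 2\<close>. Since
        \<open>e * e = 1\<close>, the constant is -1, which gives the same limit as at 0.\<close>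
      have "h s = - 2 * (e / 2) * e * wronskian (\<lambda>s. A s + B s) B' ((1 - s) / (1 + s))"
        unfolding h_def
      proof (rule wronskian_rotate)
        fix s :: real assume s: "0 < s" "s < 1"
        define t where "t = (1 - s) / (1 + s)"
        have t: "0 < t" "t < 1" using rotation_bounds[OF s] by (simp_all add: t_def)
        have tt: "(1 - t) / (1 + t) = s" "(1 + s) * (1 + t) = 2"
          using s by (simp_all add: t_def field_simps)
        have "(1 + t) * A s = e * (A t + B t)"
          using oct_A_rotate[of r, OF oct m t, of n] en by (simp add: tt defs)
        hence "(1 + s) * (1 + t) * A s = e * ((1 + s) * (A t + B t))" by simp
        thus "A s = e / 2 * ((1 + s) * (A ((1 - s) / (1 + s)) + B ((1 - s) / (1 + s))))"
          unfolding tt t_def[symmetric] by simp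
        have "e * ((1 + s) * B' t) = e * e * y s"
          using oct_B_rotate[of r, OF oct m s, of n'] by (simp add: t_def defs y_def e_def)
        thus "y s = e * ((1 + s) * B' ((1 - s) / (1 + s)))"
          unfolding e t_def by simp
      next
        show "(\<lambda>s. A s + B s) differentiable at ((1 - s) / (1 + s))"
          unfolding defs by (intro derivative_intros second rotation_bounds s)
        show "B' differentiable at ((1 - s) / (1 + s))"
          unfolding defs by (intro second rotation_bounds s)
      qed (use s in auto)
      also have "\<dots> = - wronskian (\<lambda>s. A s + B s) B' ((1 - s) / (1 + s))"
        using e by simp
      also have "\<dots> = - (wronskian A B' ((1 - s) / (1 + s)) + wronskian B B' ((1 - s) / (1 + s)))"
        by (subst wronskian_add_left) (use rotation_bounds[OF s] in \<open>auto simp: defs intro!: second\<close>)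
      finally show ?case by simp
    qed
    ultimately show ?thesis by (rule Lim_transform_eventually)
  qed
  have int_C: "set_integrable lborel {0..1} (\<lambda>s. K * C s)"
    by (intro borel_integrable_atLeastAtMost' continuous_intros C)
  have ein: "einterval 0 1 = {0<..<1 :: real}"
    by (auto simp: einterval_def)
  have FTC: "(LBINT s=0..1. C s) = - L / c0 - (- L / c0)"
  proof (rule interval_integral_FTC_integrable[where F = "\<lambda>s. h s / c0"])
    fix s :: real assume "0 < ereal s" "ereal s < 1"
    hence s: "0 < s" "s < 1" by auto
    show "((\<lambda>s. h s / c0) has_vector_derivative C s) (at s)"
      using DERIV_cdivide[OF Dh[OF s], of c0] c0
      by (simp add: has_real_derivative_iff_has_vector_derivative)
    show "isCont C s"
      using C(1) s by (auto intro: continuous_on_interior simp: interior_atLeastAtMost_real)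
  next
    show "set_integrable lborel (einterval 0 1) C"
      unfolding ein
      by (rule set_integrable_subset[OF borel_integrable_atLeastAtMost'[OF C(1)]]) auto
    have "((\<lambda>s. h s / c0) \<longlongrightarrow> - L / c0) (at_right 0)" "((\<lambda>s. h s / c0) \<longlongrightarrow> - L / c0) (at_left 1)"
      by (intro tendsto_divide tendsto_const lim0 lim1 c0)+
    thus "(((\<lambda>s. h s / c0) \<circ> real_of_ereal) \<longlongrightarrow> - L / c0) (at_right 0)"
         "(((\<lambda>s. h s / c0) \<circ> real_of_ereal) \<longlongrightarrow> - L / c0) (at_left 1)"
      by (simp_all add: ereal_tendsto_simps zero_ereal_def one_ereal_def)
  qed simp
  hence zero: "(LBINT s:{0<..<1}. C s) = 0"
    by (simp add: interval_lebesgue_integral_def ein)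
  \<comment> \<open>The integrand and \<open>K * C\<close> are known to agree only on the open
    interval; the two endpoints, where division by zero may produce default values, form a null
    set.\<close>
  have diff: "countable {0, 1 :: real}" "{0..1} - {0<..<1} \<union> ({0<..<1} - {0..1}) \<subseteq> {0, 1 :: real}"
    by auto
  have "set_integrable lborel {0<..<1} (\<lambda>s. K * C s)"
    by (rule set_integrable_subset[OF int_C]) auto
  also have "?this \<longleftrightarrow> set_integrable lborel {0<..<1} (oct_integrand r m n n')"
    by (rule set_integrable_cong) (auto simp: integrand)
  also have "\<dots> \<longleftrightarrow> set_integrable lborel {0..1} (oct_integrand r m n n')"
    by (rule set_integrable_discrete_difference[OF diff(1), symmetric]) (use diff(2) in auto)
  finally have 1: "set_integrable lborel {0..1} (oct_integrand r m n n')" .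
  have "(LBINT s:{0..1}. oct_integrand r m n n' s) = (LBINT s:{0<..<1}. oct_integrand r m n n' s)"
    by (rule set_integral_discrete_difference[OF diff(1)]) (use diff(2) in auto)
  also have "\<dots> = (LBINT s:{0<..<1}. K * C s)"
    by (rule set_lebesgue_integral_cong) (auto simp: integrand)
  also have "\<dots> = 0"
    by (simp add: zero)
  finally show ?thesis using 1 by blast
qed

end
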